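(* Let $a,b,c\in\mathbb{Z}\setminus\{0\}$ and let $m\geq 3$ be an odd integer. Consider the curves $C_{1}:\ y^2=x^m+a$, $C_{2}:\ y^2=x^m+b$, $C_{3}:\ y^2=x^m+c$. Then there exists a rational function $D\in\mathbb{Q}(u,v,w)$ such that the Jacobians of the curves $$y^2=D\,x^m+a,\qquad y^2=D\,x^m+b,\qquad y^2=x^m+cD$$ (the $m$-twists of $C_1,C_2$ by $D$ and the $2m$-twist of $C_3$ by $D$) all have positive rank over $\mathbb{Q}(u,v,w)$.
   Context: $u,v,w$ are independent indeterminates. Jacobians are those of the smooth projective models over $\mathbb{Q}(u,v,w)$; "positive rank" means the group of $\mathbb{Q}(u,v,w)$-rational points of the Jacobian contains a point of infinite order. The $m$-twist $y^2=Dx^m+a$ is isomorphic over $\mathbb{Q}(u,v,w)$ to $y^2=x^m+aD^{m-1}$. *)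

theory Defs
  imports
    "HOL-Algebra.Algebraic_Closure_Type"
    "HOL-Algebra.Free_Abelian_Groups"
    "HOL-Library.Product_Plus"
begin

text \<open>The field $\mathbf{Q}(u,v,w)$, as the fraction field of $\mathbf{Q}[u][v][w]$.\<close>

type_synonym Quvw = "rat poly poly poly fract"

text \<open>
  Let $C$ be the curve $y^2 = f(x)$ over an algebraically closed field $k$, with $f$ not a square
  in $k[x]$. Its function field is $k(x) \oplus k(x)\,y$; the pair $(A, B)$ stands for $A + B y$.
  Addition, zero and negation are the componentwise ones of the product type.
\<close>

type_synonym 'k curve_fun = "'k poly fract \<times> 'k poly fract"

definition cf_mult :: "'k::field poly \<Rightarrow> 'k curve_fun \<Rightarrow> 'k curve_fun \<Rightarrow> 'k curve_fun" where
  "cf_mult f g h =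
     (fst g * fst h + to_fract f * snd g * snd h, fst g * snd h + snd g * fst h)"

definition cf_const :: "'k::field \<Rightarrow> 'k curve_fun" where
  "cf_const c = (to_fract [:c:], 0)"

text \<open>
  The points of the smooth projective model of $C$ are the places of its function field over $k$,
  that is, the normalised discrete valuations that are trivial on $k$; the value of the valuation
  at $g \neq 0$ is the order of vanishing of $g$ at the point. The value at $0$, which carries no
  information, is fixed to be $0$ so that each place is given by exactly one function.
\<close>

definition places :: "'k::field poly \<Rightarrow> ('k curve_fun \<Rightarrow> int) set" where
  "places f = {v.
     v 0 = 0 \<and>
     (\<forall>g h. g \<noteq> 0 \<longrightarrow> h \<noteq> 0 \<longrightarrow> v (cf_mult f g h) = v g + v h) \<and>
     (\<forall>g h. g \<noteq> 0 \<longrightarrow> h \<noteq> 0 \<longrightarrow> g + h \<noteq> 0 \<longrightarrow> v (g + h) \<ge> min (v g) (v h)) \<and>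
     (\<forall>c. c \<noteq> 0 \<longrightarrow> v (cf_const c) = 0) \<and>
     (\<exists>g. g \<noteq> 0 \<and> v g = 1)}"

abbreviation Div :: "'k::field poly \<Rightarrow> (('k curve_fun \<Rightarrow> int) \<Rightarrow>\<^sub>0 int) monoid" where
  "Div f \<equiv> free_Abelian_group (places f)"

text \<open>Since $k$ is algebraically closed, every place has degree one.\<close>

definition div_degree :: "(('k curve_fun \<Rightarrow> int) \<Rightarrow>\<^sub>0 int) \<Rightarrow> int" where
  "div_degree D = (\<Sum>v\<in>Poly_Mapping.keys D. Poly_Mapping.lookup D v)"

definition principal_divisors :: "'k::field poly \<Rightarrow> (('k curve_fun \<Rightarrow> int) \<Rightarrow>\<^sub>0 int) set" where
  "principal_divisors f = {D \<in> carrier (Div f).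
     \<exists>g. g \<noteq> 0 \<and> (\<forall>v\<in>places f. Poly_Mapping.lookup D v = v g)}"

text \<open>The group of divisor classes of degree zero, a subgroup of the divisor class group.\<close>

definition Pic0 :: "'k::field poly \<Rightarrow> ((('k curve_fun \<Rightarrow> int) \<Rightarrow>\<^sub>0 int) set) monoid" where
  "Pic0 f = (Div f Mod principal_divisors f)
     \<lparr>carrier := (\<lambda>D. principal_divisors f #>\<^bsub>Div f\<^esub> D) ` {D \<in> carrier (Div f). div_degree D = 0}\<rparr>"

text \<open>
  The absolute Galois group of a perfect field \<open>'a\<close>, and its coefficientwise action on the
  function field of a curve $y^2 = f(x)$ with $f$ defined over \<open>'a\<close> (so $x$ and $y$ are fixed),
  on places and on divisors. The place $\sigma v$ is $g \mapsto v(\sigma^{-1} g)$.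
\<close>

definition galois_group :: "('a::field alg_closure \<Rightarrow> 'a alg_closure) set" where
  "galois_group = {\<sigma>. bij \<sigma> \<and> (\<forall>x y. \<sigma> (x + y) = \<sigma> x + \<sigma> y) \<and>
     (\<forall>x y. \<sigma> (x * y) = \<sigma> x * \<sigma> y) \<and> (\<forall>c. \<sigma> (to_ac c) = to_ac c)}"

definition map_ratfun :: "('k::field \<Rightarrow> 'k) \<Rightarrow> 'k poly fract \<Rightarrow> 'k poly fract" where
  "map_ratfun \<sigma> q = (THE r. \<exists>a b. b \<noteq> 0 \<and> q = Fraction_Field.Fract a b \<and>
     r = Fraction_Field.Fract (map_poly \<sigma> a) (map_poly \<sigma> b))"

lemma map_ratfun_Fract:
  assumes "\<sigma> \<in> galois_group" and "b \<noteq> 0"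
  shows "map_ratfun \<sigma> (Fraction_Field.Fract a b) =
    Fraction_Field.Fract (map_poly \<sigma> a) (map_poly \<sigma> b)"
proof -
  have add: "\<sigma> (x + y) = \<sigma> x + \<sigma> y" and mult: "\<sigma> (x * y) = \<sigma> x * \<sigma> y" for x y
    using assms by (auto simp: galois_group_def)
  have z: "\<sigma> 0 = 0"
    by (metis add add.right_neutral add_left_cancel)
  have inj: "\<sigma> x = 0 \<longleftrightarrow> x = 0" for x
    using assms z by (metis (mono_tags, lifting) bij_pointE galois_group_def mem_Collect_eq)
  have sum: "\<sigma> (\<Sum>x\<in>A. g x) = (\<Sum>x\<in>A. \<sigma> (g x))" for A and g :: "nat \<Rightarrow> 'a alg_closure"
    by (induction A rule: infinite_finite_induct) (auto simp: add z)
  have pmult: "map_poly \<sigma> (p * q) = map_poly \<sigma> p * map_poly \<sigma> q" for p q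
    by (rule poly_eqI) (simp add: coeff_map_poly z Polynomial.coeff_mult sum mult)
  have pnz: "map_poly \<sigma> p \<noteq> 0" if "p \<noteq> 0" for p
    using that by (simp add: map_poly_eq_0_iff z inj)
  show ?thesis
    unfolding map_ratfun_def
  proof (rule the_equality)
    show "\<exists>c d. d \<noteq> 0 \<and> Fraction_Field.Fract a b = Fraction_Field.Fract c d \<and>
        Fraction_Field.Fract (map_poly \<sigma> a) (map_poly \<sigma> b) =
        Fraction_Field.Fract (map_poly \<sigma> c) (map_poly \<sigma> d)"
      using assms by blast
  next
    fix r
    assume "\<exists>c d. d \<noteq> 0 \<and> Fraction_Field.Fract a b = Fraction_Field.Fract c d \<and>
        r = Fraction_Field.Fract (map_poly \<sigma> c) (map_poly \<sigma> d)"
    then obtain c d where cd: "d \<noteq> 0" "Fraction_Field.Fract a b = Fraction_Field.Fract c d"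
      "r = Fraction_Field.Fract (map_poly \<sigma> c) (map_poly \<sigma> d)" by blast
    have "a * d = c * b"
      using cd assms by (simp add: eq_fract)
    hence "map_poly \<sigma> a * map_poly \<sigma> d = map_poly \<sigma> c * map_poly \<sigma> b"
      by (metis pmult)
    thus "r = Fraction_Field.Fract (map_poly \<sigma> a) (map_poly \<sigma> b)"
      using cd assms by (simp add: eq_fract pnz)
  qed
qed

definition galois_fun :: "('k::field \<Rightarrow> 'k) \<Rightarrow> 'k curve_fun \<Rightarrow> 'k curve_fun" where
  "galois_fun \<sigma> = map_prod (map_ratfun \<sigma>) (map_ratfun \<sigma>)"

definition galois_place ::
    "('k::field \<Rightarrow> 'k) \<Rightarrow> ('k curve_fun \<Rightarrow> int) \<Rightarrow> ('k curve_fun \<Rightarrow> int)" where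
  "galois_place \<sigma> v = v \<circ> galois_fun (inv_into UNIV \<sigma>)"

definition galois_div ::
    "('k::field \<Rightarrow> 'k) \<Rightarrow> (('k curve_fun \<Rightarrow> int) \<Rightarrow>\<^sub>0 int) \<Rightarrow> (('k curve_fun \<Rightarrow> int) \<Rightarrow>\<^sub>0 int)" where
  "galois_div \<sigma> = frag_extend (\<lambda>v. frag_of (galois_place \<sigma> v))"

text \<open>
  For $C : y^2 = f(x)$ over a perfect field $K$ with Jacobian $J$, one has
  $J(\overline{K}) = \mathrm{Pic}^0(C_{\overline{K}})$ as Galois modules, and $J(K)$ is the subgroup
  of Galois-invariant classes.
\<close>

definition jacobian_points ::
    "'a::field poly \<Rightarrow> ((('a alg_closure curve_fun \<Rightarrow> int) \<Rightarrow>\<^sub>0 int) set) monoid" where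
  "jacobian_points f = (Pic0 (map_poly to_ac f))
     \<lparr>carrier := {Z \<in> carrier (Pic0 (map_poly to_ac f)).
        \<forall>\<sigma>\<in>galois_group. galois_div \<sigma> ` Z = Z}\<rparr>"

definition jacobian_positive_rank :: "'a::field poly \<Rightarrow> bool" where
  "jacobian_positive_rank f \<longleftrightarrow> (\<exists>Z \<in> carrier (jacobian_points f).
     \<forall>n::nat. n > 0 \<longrightarrow> Z [^]\<^bsub>jacobian_points f\<^esub> n \<noteq> \<one>\<^bsub>jacobian_points f\<^esub>)"

end

theory Submission
  imports Defs "HOL-Computational_Algebra.Polynomial_FPS"
begin

text \<open>
  Put \<open>y\<^sub>1 = (w - (b - a)/w)/2\<close>, \<open>y\<^sub>2 = (w + (b - a)/w)/2\<close>, so that \<open>h := y\<^sub>1\<^sup>2 - a = y\<^sub>2\<^sup>2 - b\<close>. With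
  \<open>x\<^sub>1 = 1 + c h\<close> and \<open>D = h / x\<^sub>1\<^sup>m\<close> the three curves contain the points \<open>(x\<^sub>1, y\<^sub>1)\<close>, \<open>(x\<^sub>1, y\<^sub>2)\<close> and
  \<open>(1 / x\<^sub>1, x\<^sub>1\<^bsup>-(m-1)/2\<^esup>)\<close>. For such a point \<open>P = (x\<^sub>0, y\<^sub>0)\<close> and \<open>P' = (x\<^sub>0, -y\<^sub>0)\<close> the class of
  \<open>P - P'\<close> is rational. It is not torsion: if \<open>n (P - P')\<close> is the divisor of \<open>g\<close>, then
  \<open>(x - x\<^sub>0)\<^sup>n g = A + B y\<close> with polynomials \<open>A\<close>, \<open>B\<close> whose norm \<open>A\<^sup>2 - f B\<^sup>2\<close> is a constant multiple
  of \<open>(x - x\<^sub>0)\<^bsup>2n\<^esup>\<close>. Linear algebra gives such \<open>A\<close>, \<open>B\<close> over \<open>K = Q(u,v,w)\<close> itself. Over the algebraic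
  closure the curve is constant, while \<open>P\<close> varies with \<open>w\<close>; differentiating \<open>A + B y\<close> with respect
  to \<open>w\<close> logarithmically yields a function with exactly one simple pole, contradicting genus
  \<open>\<ge> 1\<close>.
\<close>

section \<open>Logarithmic derivatives of functions with a single zero\<close>

text \<open>For nonzero \<open>A\<close> and \<open>B\<close> the degrees of \<open>A^2\<close> and
  \<open>f * B^2\<close> have opposite parity, so their leading terms cannot cancel.\<close>

lemma odd_degree_norm:
  fixes f A B :: "'a::field poly"
  assumes "odd (Polynomial.degree f)"
  shows "Polynomial.degree (A^2) \<le> Polynomial.degree (A^2 - f * B^2)"
    and "Polynomial.degree (f * B^2) \<le> Polynomial.degree (A^2 - f * B^2)"
    and "A^2 - f * B^2 = 0 \<Longrightarrow> A = 0 \<and> B = 0"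
proof -
  have f: "f \<noteq> 0"
    using assms by auto
  have "Polynomial.degree (A^2) \<le> Polynomial.degree (A^2 - f * B^2) \<and>
    Polynomial.degree (f * B^2) \<le> Polynomial.degree (A^2 - f * B^2) \<and>
    (A^2 - f * B^2 = 0 \<longrightarrow> A = 0 \<and> B = 0)"
  proof (cases "A = 0 \<or> B = 0")
    case True
    then show ?thesis
      using f by auto
  next
    case False
    have d: "Polynomial.degree (A^2) = 2 * Polynomial.degree A"
      "Polynomial.degree (f * B^2) = Polynomial.degree f + 2 * Polynomial.degree B"
      using f False by (simp_all add: degree_power_eq degree_mult_eq)
    have ne: "Polynomial.degree (A^2) \<noteq> Polynomial.degree (f * B^2)"
      unfolding d using assms by presburger
    hence "A^2 - f * B^2 \<noteq> 0"
      by auto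
    moreover have "Polynomial.degree (A^2 - f * B^2) =
        max (Polynomial.degree (A^2)) (Polynomial.degree (f * B^2))"
    proof (cases "Polynomial.degree (A^2) < Polynomial.degree (f * B^2)")
      case True
      then show ?thesis
        using degree_add_eq_right[of "A^2" "- (f * B^2)"] by simp
    next
      case False
      then show ?thesis
        using degree_add_eq_left[of "- (f * B^2)" "A^2"] ne by simp
    qed
    ultimately show ?thesis
      by simp
  qed
  thus "Polynomial.degree (A^2) \<le> Polynomial.degree (A^2 - f * B^2)"
    and "Polynomial.degree (f * B^2) \<le> Polynomial.degree (A^2 - f * B^2)"
    and "A^2 - f * B^2 = 0 \<Longrightarrow> A = 0 \<and> B = 0"
    by blast+
qed

lemma linear_power_dvd_cancel:
  fixes p q :: "'a::field poly"
  assumes "[:-x0, 1:] ^ k dvd p * q" and "poly p x0 \<noteq> 0"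
  shows "[:-x0, 1:] ^ k dvd q"
proof (cases "q = 0")
  case False
  have p: "p \<noteq> 0" using assms(2) by auto
  have "Polynomial.order x0 (p * q) = Polynomial.order x0 q"
    using False p assms(2) by (simp add: order_mult order_root order_0I)
  thus ?thesis
    using assms(1) False p by (simp add: order_divides)
qed auto

text \<open>Constants are not assumed to be killed, since the coefficients will be differentiated
  too. The degree bound keeps the numerator of a logarithmic derivative too small to be divisible by
  a high power of a linear factor.\<close>

locale poly_derivation =
  fixes d :: "'a::field_char_0 poly \<Rightarrow> 'a poly"
  assumes d_add: "d (p + q) = d p + d q"
    and d_mult: "d (p * q) = d p * q + p * d q"
    and degree_d_le: "Polynomial.degree (d p) \<le> Polynomial.degree p"
begin

lemma d_1: "d 1 = 0"
  using d_mult[of 1 1] by simp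

lemma d_minus: "d (p - q) = d p - d q"
  using d_add[of "p - q" q] by (simp add: algebra_simps)

lemma d_power: "d (p ^ n) = of_nat n * p ^ (n - 1) * d p"
proof (induction n)
  case (Suc n)
  then show ?case
    by (cases n) (simp_all add: d_mult algebra_simps)
qed (simp add: d_1)

text \<open>
  The function \<open>g = A + B y\<close> has divisor \<open>n P - n \<infinity>\<close>. As \<open>P\<close> moves under the derivation, the
  logarithmic derivative of \<open>g\<close> has a simple pole at \<open>P\<close> and no other pole, which is impossible
  in positive genus. Below \<open>U + V y\<close> is the numerator of this logarithmic derivative over the
  norm of \<open>g\<close>.
\<close>

lemma norm_eq_power_contradiction:
  assumes odd: "odd (Polynomial.degree f)" and deg3: "Polynomial.degree f \<ge> 3"
    and df: "d f = smult (2 * l) f"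
    and dx: "d [:-x0, 1:] = smult e [:-x0, 1:] + [:t:]" and t: "t \<noteq> 0"
    and eq: "A^2 - f * B^2 = smult c ([:-x0, 1:] ^ n)"
    and c: "c \<noteq> 0" and n: "n > 0" and A: "poly A x0 \<noteq> 0"
  shows False
proof -
  define T where "T = [:-x0, 1:]"
  \<comment> \<open>From \<open>d f = 2 l f\<close> and y^2 = f one gets d y = l y, so
    \<open>B'\<close> is the coefficient of y in the derivative of B y.\<close>
  define B' where "B' = d B + smult l B"
  \<comment> \<open>\<open>U + V y\<close> is the product of the conjugate \<open>A - B y\<close>
    with the derivative \<open>d A + B' y\<close>.\<close>
  define U where "U = A * d A - f * B * B'"
  define V where "V = A * B' - B * d A"
  have T0: "poly T x0 = 0" and Tn: "Polynomial.degree (T ^ k) = k" for k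
    by (simp_all add: T_def degree_linear_power)
  obtain c' where c': "d [:c:] = [:c':]"
    using degree_d_le[of "[:c:]"] by (metis degree_eq_zeroE degree_pCons_0 le_zero_eq)
  have degT: "Polynomial.degree (smult c (T ^ n)) = n"
    using c Tn by simp
  have dA: "2 * Polynomial.degree A \<le> n"
    using odd_degree_norm(1)[OF odd, of A B] degT A
    by (cases "A = 0") (auto simp: eq T_def degree_power_eq)
  have evA: "(poly A x0)\<^sup>2 - poly f x0 * (poly B x0)\<^sup>2 = 0"
    using arg_cong[OF eq, of "\<lambda>p. poly p x0"] n by simp
  hence B0: "poly B x0 \<noteq> 0"
    using A by auto
  hence dB: "Polynomial.degree f + 2 * Polynomial.degree B \<le> n"
    using odd_degree_norm(2)[OF odd, of B A] degT deg3
    by (cases "B = 0 \<or> f = 0") (auto simp: eq T_def degree_power_eq degree_mult_eq)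
  have dB': "Polynomial.degree B' \<le> Polynomial.degree B"
    unfolding B'_def by (intro degree_add_le degree_d_le degree_smult_le)
  have dV: "Polynomial.degree V \<le> Polynomial.degree A + Polynomial.degree B"
    unfolding V_def
    using dB' degree_d_le[of A] degree_mult_le[of A B'] degree_mult_le[of B "d A"]
    by (intro degree_diff_le) linarith+
  \<comment> \<open>Here positive genus enters: 2 deg A is at most n and 2 deg B at most n -
    3.\<close>
  have dVn: "Polynomial.degree V < n - 1"
    using dV dA dB deg3 by linarith
  have e1: "A * V + B * U = B' * smult c (T ^ n)"
    unfolding T_def eq[symmetric] U_def V_def by (simp add: algebra_simps power2_eq_square)
  define l' where "l' = [:l:]"
  have df': "d f = 2 * (l' * f)" and B'': "B' = d B + l' * B" and U2: "smult 2 U = 2 * U"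
    by (simp_all add: l'_def df B'_def numeral_mult_conv_smult mult.commute[of l 2])
  \<comment> \<open>\<open>2 U\<close> is the derivative of the norm, which is a constant times
    \<open>T ^ n\<close>; this gives its expansion in powers of \<open>T\<close>.\<close>
  have "smult 2 U = d (A^2 - f * B^2)"
    unfolding U2 unfolding U_def B'' d_minus d_mult power2_eq_square df'
    by (simp add: algebra_simps)
  also have "\<dots> = d ([:c:] * T ^ n)"
    unfolding eq T_def by simp
  also have "\<dots> = [:c':] * T ^ n + [:c:] * (of_nat n * T ^ (n - 1) * (smult e T + [:t:]))"
    by (simp only: d_mult d_power c' dx T_def)
  also have "\<dots> = [:c' + of_nat n * c * e:] * T ^ n + [:of_nat n * c * t:] * T ^ (n - 1)"
    using n by (cases n) (simp_all add: algebra_simps of_nat_poly smult_add_left)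
  finally have U: "smult 2 U =
    [:c' + of_nat n * c * e:] * T ^ n + [:of_nat n * c * t:] * T ^ (n - 1)" .
  have Tle: "T ^ (n - 1) dvd T ^ n"
    by (rule le_imp_power_dvd) simp
  have "T ^ (n - 1) dvd smult 2 U"
    unfolding U using Tle by (intro dvd_add dvd_mult) auto
  hence "T ^ (n - 1) dvd U"
    by (simp add: dvd_smult_iff)
  \<comment> \<open>The identity \<open>e1\<close> carries the divisibility from \<open>U\<close>
    over to \<open>V\<close>, because \<open>A\<close> does not vanish at \<open>x0\<close>.\<close>
  hence "T ^ (n - 1) dvd (A * V + B * U) - B * U"
    unfolding e1 using Tle by (intro dvd_diff dvd_mult dvd_smult) auto
  hence "T ^ (n - 1) dvd V"
    using A linear_power_dvd_cancel[of x0 "n - 1" A V] by (simp add: T_def)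
  hence V0: "V = 0"
    using dVn Tn[of "n - 1"] dvd_imp_degree_le[of "T ^ (n - 1)" V] by fastforce
  \<comment> \<open>With \<open>V = 0\<close>, \<open>e1\<close> forces \<open>T ^ n\<close> to
    divide \<open>U\<close>, whereas the coefficient \<open>n c t\<close> of
    \<open>T ^ (n - 1)\<close> in \<open>2 U\<close> is nonzero.\<close>
  hence "T ^ n dvd B * U"
    using e1 by (simp add: dvd_smult)
  hence "T ^ n dvd U"
    using B0 linear_power_dvd_cancel[of x0 n B U] by (simp add: T_def)
  hence "T ^ n dvd smult 2 U - [:c' + of_nat n * c * e:] * T ^ n"
    by (intro dvd_diff dvd_mult dvd_smult) auto
  hence "T ^ n dvd [:of_nat n * c * t:] * T ^ (n - 1)"
    unfolding U by simp
  moreover have "[:of_nat n * c * t:] * T ^ (n - 1) \<noteq> 0"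
    using n c t by (simp add: T_def)
  ultimately have "n \<le> Polynomial.degree ([:of_nat n * c * t:] * T ^ (n - 1))"
    using dvd_imp_degree_le[of "T ^ n" "[:of_nat n * c * t:] * T ^ (n - 1)"] Tn by auto
  also have "\<dots> = n - 1"
    using n c t Tn by simp
  finally show False
    using n by simp
qed

end

text \<open>The coefficientwise \<open>D\<close> and the Euler operator x d/dx are both derivations
  that do not raise degrees. The sum sends x to e x, which leaves \<open>e\<close> free to be
  adapted to a given curve.\<close>

lemma poly_derivation_twisted:
  fixes D :: "'a::field_char_0 \<Rightarrow> 'a"
  assumes add: "\<And>x y. D (x + y) = D x + D y"
    and mult: "\<And>x y. D (x * y) = D x * y + x * D y"
  shows "poly_derivation (\<lambda>p. map_poly D p + smult e ([:0, 1:] * pderiv p))"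
proof
  have D0: "D 0 = 0"
    using add[of 0 0] by simp
  have sum: "D (sum h S) = (\<Sum>x\<in>S. D (h x))" for h and S :: "nat set"
    by (induction S rule: infinite_finite_induct) (auto simp: add D0)
  fix p q :: "'a poly"
  have madd: "map_poly D (p + q) = map_poly D p + map_poly D q"
    by (rule poly_eqI) (simp add: coeff_map_poly D0 add)
  show "map_poly D (p + q) + smult e ([:0, 1:] * pderiv (p + q)) =
       map_poly D p + smult e ([:0, 1:] * pderiv p) + (map_poly D q + smult e ([:0, 1:] * pderiv q))"
    unfolding madd pderiv_add by (simp add: algebra_simps smult_add_right)
  have mmult: "map_poly D (p * q) = map_poly D p * q + p * map_poly D q"
    by (rule poly_eqI)
      (simp add: coeff_map_poly D0 Polynomial.coeff_mult sum mult sum.distrib)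
  show "map_poly D (p * q) + smult e ([:0, 1:] * pderiv (p * q)) =
       (map_poly D p + smult e ([:0, 1:] * pderiv p)) * q +
       p * (map_poly D q + smult e ([:0, 1:] * pderiv q))"
    unfolding mmult pderiv_mult by (simp add: algebra_simps smult_add_right)
  show "Polynomial.degree (map_poly D p + smult e ([:0, 1:] * pderiv p)) \<le> Polynomial.degree p"
  proof (rule degree_add_le)
    show "Polynomial.degree (map_poly D p) \<le> Polynomial.degree p"
      by (rule map_poly_degree_leq)
    show "Polynomial.degree (smult e ([:0, 1:] * pderiv p)) \<le> Polynomial.degree p"
      by (cases "Polynomial.degree p = 0")
        (auto simp: pderiv_eq_0_iff degree_pderiv intro!: order.trans[OF degree_smult_le]
          order.trans[OF degree_pCons_le])
  qed
qed

section \<open>Descent from the algebraic closure\<close>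

text \<open>Hensel lifting: 2 y0 is invertible, so an approximate square root can be improved one
  power of \<open>x - x0\<close> at a time.\<close>

lemma sqrt_mod_linear_power:
  fixes f :: "'a::field_char_0 poly"
  assumes "poly f x0 = y0^2" and "y0 \<noteq> 0"
  shows "\<exists>Y. [:-x0, 1:] ^ Suc n dvd Y^2 - f \<and> poly Y x0 = y0"
proof (induction n)
  case 0
  show ?case
    using assms by (intro exI[of _ "[:y0:]"]) (simp add: poly_eq_0_iff_dvd[symmetric] power2_eq_square)
next
  case (Suc n)
  define T where "T = [:-x0, 1:]"
  obtain Y q where Y: "Y^2 - f = T ^ Suc n * q" "poly Y x0 = y0"
    using Suc unfolding T_def dvd_def by blast
  \<comment> \<open>Newton correction: \<open>q'\<close> takes the value q(x0) + 2 t y0 at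
    \<open>x0\<close>, and this \<open>t\<close> makes it vanish.\<close>
  define t where "t = - poly q x0 / (2 * y0)"
  define t' where "t' = [:t:]"
  define T' where "T' = T ^ Suc n"
  define q' where "q' = q + 2 * t' * Y + t'^2 * T'"
  have "poly q' x0 = 0"
    using assms(2) Y(2) by (simp add: q'_def t'_def T'_def t_def T_def field_simps)
  hence "T dvd q'"
    by (simp add: T_def poly_eq_0_iff_dvd)
  moreover have "(Y + t' * T')^2 - f = T' * q'"
  proof -
    have "(Y + t' * T')^2 - f = (Y^2 - f) + T' * (2 * t' * Y + t'^2 * T')"
      by (simp add: power2_eq_square algebra_simps)
    thus ?thesis
      unfolding Y(1) q'_def T'_def[symmetric] by (simp only: algebra_simps)
  qed
  ultimately have "T * T' dvd (Y + t' * T')^2 - f"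
    by (simp add: mult.commute mult_dvd_mono)
  moreover have "poly (Y + t' * T') x0 = y0"
    using Y(2) by (simp add: T'_def T_def)
  ultimately show ?case
    unfolding T'_def T_def power_Suc[symmetric] by blast
qed

abbreviation ac_poly :: "'a::field poly \<Rightarrow> 'a alg_closure poly" where
  "ac_poly \<equiv> map_poly to_ac"

lemma ac_poly_add: "ac_poly (p + q) = ac_poly p + ac_poly q"
  by (rule poly_eqI) (simp add: coeff_map_poly)

lemma ac_poly_diff: "ac_poly (p - q) = ac_poly p - ac_poly q"
  by (rule poly_eqI) (simp add: coeff_map_poly)

lemma ac_poly_mult: "ac_poly (p * q) = ac_poly p * ac_poly q"
  by (rule poly_eqI) (simp add: coeff_map_poly Polynomial.coeff_mult to_ac_sum)

lemma ac_poly_power: "ac_poly (p ^ n) = ac_poly p ^ n"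
  by (induction n) (simp_all add: ac_poly_mult)

lemma ac_poly_pCons: "ac_poly (pCons c p) = pCons (to_ac c) (ac_poly p)"
  by (rule map_poly_pCons) simp

lemma degree_ac_poly: "Polynomial.degree (ac_poly p) = Polynomial.degree p"
  by (rule degree_map_poly) simp

lemma poly_ac_poly: "poly (ac_poly p) (to_ac x) = to_ac (poly p x)"
  by (induction p) (simp_all add: ac_poly_pCons)

text \<open>The embedding is an injective linear map of vector spaces over the ground field, so it
  has a linear left inverse. No multiplicativity is claimed; only linear conditions will be
  transported.\<close>

lemma ac_retraction_exists:
  obtains L :: "'a::field alg_closure \<Rightarrow> 'a"
  where "\<And>x y. L (x + y) = L x + L y" and "\<And>c x. L (to_ac c * x) = c * L x"
    and "\<And>c. L (to_ac c) = c"
proof -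
  interpret vector_space_pair "(*) :: 'a \<Rightarrow> 'a \<Rightarrow> 'a"
    "\<lambda>(c::'a) (x::'a alg_closure). to_ac c * x"
    by unfold_locales (simp_all add: algebra_simps)
  have "Vector_Spaces.linear (*) (\<lambda>(c::'a) (x::'a alg_closure). to_ac c * x) to_ac"
    by unfold_locales simp_all
  then obtain g where g: "Vector_Spaces.linear (\<lambda>(c::'a) (x::'a alg_closure). to_ac c * x) (*) g"
      "g \<circ> to_ac = id"
    using linear_injective_left_inverse inj_to_ac by blast
  interpret g: Vector_Spaces.linear "\<lambda>(c::'a) (x::'a alg_closure). to_ac c * x" "(*)" g
    by (fact g)
  show thesis
    using g(2) by (intro that[of g]) (auto simp: g.add g.scale o_def fun_eq_iff)
qed

text \<open>
  Divisibility of \<open>A + B Y\<close> by a power of \<open>x - x0\<close> is a linear condition on \<open>(A, B)\<close>, hence stable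
  under applying a \<open>K\<close>-linear retraction of \<open>K \<rightarrow> K\<^sup>a\<^sup>c\<close> to the coefficients.
\<close>

lemma norm_eq_power_descent:
  fixes f :: "'a::field_char_0 poly"
  assumes odd: "odd (Polynomial.degree f)"
    and y0: "poly f x0 = y0^2" "y0 \<noteq> 0"
    and eq: "A^2 - ac_poly f * B^2 = smult c ([:- to_ac x0, 1:] ^ n)"
    and n: "n > 0"
    and P: "poly A (to_ac x0) + poly B (to_ac x0) * to_ac y0 = 0"
    and A: "poly A (to_ac x0) \<noteq> 0"
  shows "\<exists>A B c. A^2 - f * B^2 = smult c ([:-x0, 1:] ^ n) \<and> c \<noteq> 0 \<and> poly A x0 \<noteq> 0"
proof -
  obtain L :: "'a alg_closure \<Rightarrow> 'a" where L: "\<And>x y. L (x + y) = L x + L y"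
    "\<And>c x. L (to_ac c * x) = c * L x" "\<And>c. L (to_ac c) = c"
    by (rule ac_retraction_exists) blast
  have L0: "L 0 = 0"
    using L(3)[of 0] by simp
  have Lsum: "L (sum h S) = (\<Sum>x\<in>S. L (h x))" for h and S :: "nat set"
    by (induction S rule: infinite_finite_induct) (auto simp: L L0)
  have mL_add: "map_poly L (p + q) = map_poly L p + map_poly L q" for p q
    by (rule poly_eqI) (simp add: coeff_map_poly L0 L)
  have mL_mult: "map_poly L (ac_poly p * q) = p * map_poly L q" for p q
    by (rule poly_eqI) (simp add: coeff_map_poly L0 L Polynomial.coeff_mult Lsum)
  have poly_mL: "poly (map_poly L p) x0 = L (poly p (to_ac x0))" for p
    by (induction p) (simp_all add: map_poly_pCons L L0)
  define T where "T = [:-x0, 1:]"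
  have acT: "ac_poly T = [:- to_ac x0, 1:]"
    by (simp add: T_def ac_poly_pCons)
  \<comment> \<open>\<open>Y\<close> replaces y in the local expansion at the point, up to order
    \<open>n\<close>.\<close>
  obtain Y where Y: "T ^ n dvd Y^2 - f" "poly Y x0 = y0"
    using sqrt_mod_linear_power[OF y0, of "n - 1"] n by (auto simp: T_def)
  \<comment> \<open>Scaling to \<open>A(x0) = 1\<close> ensures that the value at \<open>x0\<close>
    survives \<open>L\<close>, which fixes 1 but could kill other nonzero elements.\<close>
  define s where "s = inverse (poly A (to_ac x0))"
  define A1 where "A1 = smult s A"
  define B1 where "B1 = smult s B"
  have A1: "poly A1 (to_ac x0) = 1" "poly A1 (to_ac x0) + poly B1 (to_ac x0) * to_ac y0 = 0"
    using A P by (simp_all add: A1_def B1_def s_def field_simps)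
  have eq1: "A1^2 - ac_poly f * B1^2 = smult (s^2 * c) (ac_poly T ^ n)"
    unfolding smult_smult[symmetric] acT eq[symmetric]
    by (simp add: A1_def B1_def power2_eq_square smult_diff_right)
  \<comment> \<open>Modulo \<open>T ^ n\<close> this product is the norm. The first factor has the
    value 2 at \<open>x0\<close>, so the whole power divides the second, a condition linear in
    \<open>(A1, B1)\<close>.\<close>
  have "ac_poly T ^ n dvd (A1 - B1 * ac_poly Y) * (A1 + B1 * ac_poly Y)"
  proof -
    have "(A1 - B1 * ac_poly Y) * (A1 + B1 * ac_poly Y) =
        (A1^2 - ac_poly f * B1^2) - B1^2 * ac_poly (Y^2 - f)"
      by (simp add: ac_poly_diff ac_poly_mult algebra_simps power2_eq_square)
    moreover have "ac_poly T ^ n dvd ac_poly (Y^2 - f)"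
      using Y(1) unfolding dvd_def by (auto simp: ac_poly_mult ac_poly_power)
    ultimately show ?thesis
      unfolding eq1 by (auto intro!: dvd_diff dvd_smult)
  qed
  moreover have "poly (A1 - B1 * ac_poly Y) (to_ac x0) \<noteq> 0"
    using A1 by (auto simp: poly_ac_poly Y(2))
  ultimately have "ac_poly T ^ n dvd A1 + B1 * ac_poly Y"
    unfolding acT by (rule linear_power_dvd_cancel)
  then obtain q where "A1 + ac_poly Y * B1 = ac_poly (T ^ n) * q"
    by (auto simp: dvd_def ac_poly_power mult.commute)
  hence q: "map_poly L A1 + Y * map_poly L B1 = T ^ n * map_poly L q"
    by (metis mL_add mL_mult)
  define A2 where "A2 = map_poly L A1"
  define B2 where "B2 = map_poly L B1"
  have A2: "poly A2 x0 = 1"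
    using L(3)[of 1] by (simp add: A2_def poly_mL A1)
  have "T ^ n dvd (A2 + Y * B2) * (A2 - Y * B2) + B2^2 * (Y^2 - f)"
    unfolding A2_def B2_def q using Y(1) by simp
  also have "\<dots> = A2^2 - f * B2^2"
    by (simp add: algebra_simps power2_eq_square)
  finally obtain r where r: "A2^2 - f * B2^2 = T ^ n * r"
    by (auto simp: dvd_def)
  have nz: "A2^2 - f * B2^2 \<noteq> 0"
    using odd_degree_norm(3)[OF odd, of A2 B2] A2 by auto
  have degT: "Polynomial.degree (T ^ n) = n"
    by (simp add: T_def degree_linear_power)
  have "A1 \<noteq> 0"
    using A1 by auto
  have le: "Polynomial.degree (smult (s^2 * c) (ac_poly T ^ n)) \<le> n"
    unfolding acT by (rule order.trans[OF degree_smult_le]) (simp add: degree_linear_power)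
  \<comment> \<open>\<open>L\<close> does not raise degrees, so the bounds for the original pair
    still hold; they force the cofactor \<open>r\<close> of \<open>T ^ n\<close> to be
    constant.\<close>
  have d1: "Polynomial.degree (A2^2) \<le> n"
  proof -
    have "Polynomial.degree (A2^2) \<le> 2 * Polynomial.degree A1"
      using degree_power_le[of A2 2] map_poly_degree_leq[of L A1] by (simp add: A2_def)
    also have "\<dots> = Polynomial.degree (A1^2)"
      using \<open>A1 \<noteq> 0\<close> by (simp add: degree_power_eq)
    also have "\<dots> \<le> n"
      using odd_degree_norm(1)[of "ac_poly f" A1 B1] odd le by (simp add: eq1 degree_ac_poly)
    finally show ?thesis .
  qed
  have acf: "ac_poly f \<noteq> 0"
    using odd degree_ac_poly[of f] by auto
  have d2: "Polynomial.degree (f * B2^2) \<le> n"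
  proof (cases "B1 = 0")
    case False
    have "Polynomial.degree (B2^2) \<le> 2 * Polynomial.degree B1"
      using degree_power_le[of B2 2] map_poly_degree_leq[of L B1] by (simp add: B2_def)
    hence "Polynomial.degree (f * B2^2) \<le> Polynomial.degree f + 2 * Polynomial.degree B1"
      using degree_mult_le[of f "B2^2"] by linarith
    also have "\<dots> = Polynomial.degree (ac_poly f * B1^2)"
      using False acf by (simp add: degree_mult_eq degree_power_eq degree_ac_poly)
    also have "\<dots> \<le> n"
      using odd_degree_norm(2)[of "ac_poly f" B1 A1] odd le by (simp add: eq1 degree_ac_poly)
    finally show ?thesis .
  qed (simp add: B2_def)
  have "Polynomial.degree (T ^ n * r) \<le> n"
    unfolding r[symmetric] using d1 d2 by (rule degree_diff_le)
  moreover have "r \<noteq> 0"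
    using nz r by auto
  ultimately have "Polynomial.degree r = 0"
    using degT degree_mult_eq[of "T ^ n" r] by (cases "T ^ n = 0") (auto simp: T_def)
  then obtain c' where c': "r = [:c':]"
    by (rule degree_eq_zeroE)
  have "A2^2 - f * B2^2 = smult c' ([:-x0, 1:] ^ n)"
    unfolding r c' T_def by simp
  moreover have "c' \<noteq> 0" "poly A2 x0 \<noteq> 0"
    using A2 \<open>r \<noteq> 0\<close> c' by auto
  ultimately show ?thesis
    by blast
qed

section \<open>Places from power series expansions\<close>

unbundle fps_syntax

text \<open>
  A substitution \<open>x \<mapsto> r(t)\<close>, \<open>y \<mapsto> \<eta>(t)\<close> embeds the function field into \<open>k((t))\<close> and the order in
  \<open>t\<close> becomes a valuation. Functions are written as \<open>(A + B y) / d\<close> with polynomials \<open>A\<close>, \<open>B\<close>, \<open>d\<close>,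
  so that only power series without negative exponents occur.
\<close>

definition subst_fps :: "'k::field poly \<Rightarrow> 'k poly \<Rightarrow> 'k fps" where
  "subst_fps r p = fps_of_poly (pcompose p r)"

definition curve_fps :: "'k::field poly \<Rightarrow> 'k fps \<Rightarrow> 'k poly \<Rightarrow> 'k poly \<Rightarrow> 'k fps" where
  "curve_fps r \<eta> A B = subst_fps r A + subst_fps r B * \<eta>"

definition series_val :: "'k::field poly \<Rightarrow> 'k fps \<Rightarrow> 'k curve_fun \<Rightarrow> int" where
  "series_val r \<eta> g = (if g = 0 then 0 else
     (THE z. \<exists>A B d. d \<noteq> 0 \<and> g = (Fraction_Field.Fract A d, Fraction_Field.Fract B d) \<and>
        z = int (subdegree (curve_fps r \<eta> A B)) - int (subdegree (subst_fps r d))))"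

section \<open>Arithmetic of the function field with common denominators\<close>

lemma curve_fun_common_denominator:
  obtains A B d where "d \<noteq> 0"
    and "g = (Fraction_Field.Fract A d, Fraction_Field.Fract B d)"
proof -
  obtain A a where A: "fst g = Fraction_Field.Fract A a" "a \<noteq> 0"
    by (cases "fst g") auto
  obtain B b where B: "snd g = Fraction_Field.Fract B b" "b \<noteq> 0"
    by (cases "snd g") auto
  have "g = (Fraction_Field.Fract (A * b) (a * b), Fraction_Field.Fract (B * a) (a * b))"
    using A B by (simp add: prod_eq_iff eq_fract algebra_simps)
  thus thesis
    using that[of "a * b" "A * b" "B * a"] A(2) B(2) by simp
qed

lemma Fract_add_same:
  "d \<noteq> 0 \<Longrightarrow> Fraction_Field.Fract a d + Fraction_Field.Fract b d = Fraction_Field.Fract (a + b) d"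
  by (simp add: eq_fract algebra_simps)

lemma cf_mult_Fract:
  assumes "d \<noteq> 0" "d' \<noteq> 0"
  shows "cf_mult f (Fraction_Field.Fract A d, Fraction_Field.Fract B d)
      (Fraction_Field.Fract A' d', Fraction_Field.Fract B' d') =
    (Fraction_Field.Fract (A * A' + f * B * B') (d * d'),
     Fraction_Field.Fract (A * B' + B * A') (d * d'))"
  using assms by (simp add: cf_mult_def to_fract_def Fract_add_same del: add_fract)

lemma Fract_pair_eq_0_iff:
  "d \<noteq> 0 \<Longrightarrow> (Fraction_Field.Fract A d, Fraction_Field.Fract B d) = 0 \<longleftrightarrow> A = 0 \<and> B = 0"
  by (simp add: zero_prod_def Zero_fract_def eq_fract)

text \<open>The norm \<open>A^2 - f * B^2\<close> is multiplicative and vanishes only at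
  zero.\<close>

lemma cf_mult_nonzero:
  assumes odd: "odd (Polynomial.degree f)" and "g \<noteq> 0" "h \<noteq> 0"
  shows "cf_mult f g h \<noteq> 0"
proof -
  obtain A B d where g: "d \<noteq> 0" "g = (Fraction_Field.Fract A d, Fraction_Field.Fract B d)"
    by (rule curve_fun_common_denominator)
  obtain A' B' d' where h: "d' \<noteq> 0" "h = (Fraction_Field.Fract A' d', Fraction_Field.Fract B' d')"
    by (rule curve_fun_common_denominator)
  have nz: "A \<noteq> 0 \<or> B \<noteq> 0" "A' \<noteq> 0 \<or> B' \<noteq> 0"
    using assms g h by (auto simp: Fract_pair_eq_0_iff)
  have "(A * A' + f * B * B')^2 - f * (A * B' + B * A')^2 = (A^2 - f * B^2) * (A'^2 - f * B'^2)"
    by (simp add: algebra_simps power2_eq_square)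
  moreover have "\<dots> \<noteq> 0"
    using odd_degree_norm(3)[OF odd] nz by (metis mult_eq_0_iff)
  ultimately have "\<not> (A * A' + f * B * B' = 0 \<and> A * B' + B * A' = 0)"
    by auto
  thus ?thesis
    using g h by (simp add: cf_mult_Fract Fract_pair_eq_0_iff)
qed

lemma subst_fps_add: "subst_fps r (p + q) = subst_fps r p + subst_fps r q"
  by (simp add: subst_fps_def pcompose_add fps_of_poly_add)

lemma subst_fps_mult: "subst_fps r (p * q) = subst_fps r p * subst_fps r q"
  by (simp add: subst_fps_def pcompose_mult fps_of_poly_mult)

lemma subst_fps_0 [simp]: "subst_fps r 0 = 0" and subst_fps_1 [simp]: "subst_fps r 1 = 1"
  by (simp_all add: subst_fps_def pcompose_1)

lemma subst_fps_power: "subst_fps r (p ^ n) = subst_fps r p ^ n"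
  by (induction n) (simp_all add: subst_fps_mult)

lemma subst_fps_const: "subst_fps r [:c:] = fps_const c"
  by (simp add: subst_fps_def fps_of_poly_const)

lemma subst_fps_nth_0: "subst_fps r p $ 0 = poly p (poly r 0)"
  by (simp add: subst_fps_def poly_0_coeff_0[symmetric] poly_pcompose)

text \<open>The square condition makes x -> r(t), y -> \<eta>(t) compatible with y^2 = f;
  \<open>r\<close> being nonconstant makes the substitution injective on polynomials in x, and the
  norm extends this to the whole function field.\<close>

locale series_param =
  fixes f r :: "'k::field poly" and \<eta> :: "'k fps"
  assumes odd_degree: "odd (Polynomial.degree f)"
    and degree_r: "Polynomial.degree r > 0"
    and eta_square: "\<eta>^2 = subst_fps r f"
begin

lemma subst_fps_eq_0_iff: "subst_fps r p = 0 \<longleftrightarrow> p = 0"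
  using degree_r by (auto simp: subst_fps_def pcompose_eq_0_iff)

lemma curve_fps_mult:
  "curve_fps r \<eta> (A * A' + f * B * B') (A * B' + B * A') =
     curve_fps r \<eta> A B * curve_fps r \<eta> A' B'"
  by (simp add: curve_fps_def subst_fps_add subst_fps_mult eta_square[symmetric]
      algebra_simps power2_eq_square)

lemma curve_fps_conj:
  "curve_fps r \<eta> A B * curve_fps r \<eta> A (- B) = subst_fps r (A^2 - f * B^2)"
  using curve_fps_mult[of A A B "- B"]
  by (simp add: curve_fps_def algebra_simps power2_eq_square)

lemma curve_fps_nonzero: "A \<noteq> 0 \<or> B \<noteq> 0 \<Longrightarrow> curve_fps r \<eta> A B \<noteq> 0"
  using curve_fps_conj[of A B] odd_degree_norm(3)[OF odd_degree, of A B]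
  by (auto simp: subst_fps_eq_0_iff)

text \<open>Cross-multiplying two representations and comparing orders shows that the definite
  description in \<open>series_val\<close> has a unique value.\<close>

lemma series_val_Fract:
  assumes "d \<noteq> 0" and nz: "A \<noteq> 0 \<or> B \<noteq> 0"
  shows "series_val r \<eta> (Fraction_Field.Fract A d, Fraction_Field.Fract B d) =
    int (subdegree (curve_fps r \<eta> A B)) - int (subdegree (subst_fps r d))"
proof -
  let ?g = "(Fraction_Field.Fract A d, Fraction_Field.Fract B d)"
  have "int (subdegree (curve_fps r \<eta> A' B')) - int (subdegree (subst_fps r d')) =
      int (subdegree (curve_fps r \<eta> A B)) - int (subdegree (subst_fps r d))"
    if d': "d' \<noteq> 0" and eq: "?g = (Fraction_Field.Fract A' d', Fraction_Field.Fract B' d')"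
    for A' B' d'
  proof -
    have e: "A * d' = A' * d" "B * d' = B' * d"
      using that assms by (auto simp: eq_fract)
    hence nz': "A' \<noteq> 0 \<or> B' \<noteq> 0"
      using nz d' by auto
    have "curve_fps r \<eta> A B * subst_fps r d' = subst_fps r (A * d') + subst_fps r (B * d') * \<eta>"
      by (simp add: curve_fps_def subst_fps_mult algebra_simps)
    also have "\<dots> = curve_fps r \<eta> A' B' * subst_fps r d"
      unfolding e by (simp add: curve_fps_def subst_fps_mult algebra_simps)
    finally have "subdegree (curve_fps r \<eta> A B) + subdegree (subst_fps r d') =
        subdegree (curve_fps r \<eta> A' B') + subdegree (subst_fps r d)"
      using curve_fps_nonzero[OF nz] curve_fps_nonzero[OF nz'] d' assms(1)
      by (metis subdegree_mult subst_fps_eq_0_iff)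
    thus ?thesis
      by linarith
  qed
  hence "(THE z. \<exists>A' B' d'. d' \<noteq> 0 \<and>
        ?g = (Fraction_Field.Fract A' d', Fraction_Field.Fract B' d') \<and>
        z = int (subdegree (curve_fps r \<eta> A' B')) - int (subdegree (subst_fps r d'))) =
      int (subdegree (curve_fps r \<eta> A B)) - int (subdegree (subst_fps r d))"
    using assms(1) by (intro the_equality) blast+
  moreover have "?g \<noteq> 0"
    using assms by (simp add: Fract_pair_eq_0_iff)
  ultimately show ?thesis
    unfolding series_val_def by (simp only: if_False)
qed

lemma series_val_poly:
  assumes "A \<noteq> 0 \<or> B \<noteq> 0"
  shows "series_val r \<eta> (to_fract A, to_fract B) = int (subdegree (curve_fps r \<eta> A B))"
  using series_val_Fract[of 1 A B] assms by (simp add: to_fract_def)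

lemma series_val_mult:
  assumes "g \<noteq> 0" "h \<noteq> 0"
  shows "series_val r \<eta> (cf_mult f g h) = series_val r \<eta> g + series_val r \<eta> h"
proof -
  obtain A B d where g: "d \<noteq> 0" "g = (Fraction_Field.Fract A d, Fraction_Field.Fract B d)"
    by (rule curve_fun_common_denominator)
  obtain A' B' d' where h: "d' \<noteq> 0" "h = (Fraction_Field.Fract A' d', Fraction_Field.Fract B' d')"
    by (rule curve_fun_common_denominator)
  have nz: "A \<noteq> 0 \<or> B \<noteq> 0" "A' \<noteq> 0 \<or> B' \<noteq> 0"
    using assms g h by (auto simp: Fract_pair_eq_0_iff)
  have "cf_mult f g h \<noteq> 0"
    by (rule cf_mult_nonzero[OF odd_degree assms])
  hence nz'': "A * A' + f * B * B' \<noteq> 0 \<or> A * B' + B * A' \<noteq> 0"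
    using g h by (simp add: cf_mult_Fract Fract_pair_eq_0_iff)
  show ?thesis
    using g h nz nz'' curve_fps_nonzero
    by (simp add: cf_mult_Fract series_val_Fract curve_fps_mult subst_fps_mult subst_fps_eq_0_iff)
qed

lemma series_val_add:
  assumes "g \<noteq> 0" "h \<noteq> 0" "g + h \<noteq> 0"
  shows "series_val r \<eta> (g + h) \<ge> min (series_val r \<eta> g) (series_val r \<eta> h)"
proof -
  obtain A B d where g: "d \<noteq> 0" "g = (Fraction_Field.Fract A d, Fraction_Field.Fract B d)"
    by (rule curve_fun_common_denominator)
  obtain A' B' d' where h: "d' \<noteq> 0" "h = (Fraction_Field.Fract A' d', Fraction_Field.Fract B' d')"
    by (rule curve_fun_common_denominator)
  have nz: "A \<noteq> 0 \<or> B \<noteq> 0" "A' \<noteq> 0 \<or> B' \<noteq> 0"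
    using assms g h by (auto simp: Fract_pair_eq_0_iff)
  have gh: "g + h = (Fraction_Field.Fract (A * d' + A' * d) (d * d'),
      Fraction_Field.Fract (B * d' + B' * d) (d * d'))"
    using g h by simp
  hence nz'': "A * d' + A' * d \<noteq> 0 \<or> B * d' + B' * d \<noteq> 0"
    using g h assms(3) by (simp add: Fract_pair_eq_0_iff)
  have e: "curve_fps r \<eta> (A * d' + A' * d) (B * d' + B' * d) =
      curve_fps r \<eta> A B * subst_fps r d' + curve_fps r \<eta> A' B' * subst_fps r d"
    by (simp add: curve_fps_def subst_fps_add subst_fps_mult algebra_simps)
  have "subdegree (curve_fps r \<eta> (A * d' + A' * d) (B * d' + B' * d)) \<ge>
      min (subdegree (curve_fps r \<eta> A B * subst_fps r d'))
        (subdegree (curve_fps r \<eta> A' B' * subst_fps r d))"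
    using curve_fps_nonzero[OF nz''] unfolding e by (rule subdegree_add_ge')
  moreover have "subdegree (curve_fps r \<eta> A B * subst_fps r d') =
      subdegree (curve_fps r \<eta> A B) + subdegree (subst_fps r d')"
    "subdegree (curve_fps r \<eta> A' B' * subst_fps r d) =
      subdegree (curve_fps r \<eta> A' B') + subdegree (subst_fps r d)"
    "subdegree (subst_fps r (d * d')) = subdegree (subst_fps r d) + subdegree (subst_fps r d')"
    using curve_fps_nonzero[OF nz(1)] curve_fps_nonzero[OF nz(2)] g(1) h(1)
    by (simp_all add: subst_fps_eq_0_iff subst_fps_mult)
  ultimately show ?thesis
    unfolding gh using g h nz nz'' by (simp add: series_val_Fract)
qed

lemma series_val_place:
  assumes "g \<noteq> 0" and "series_val r \<eta> g = 1"
  shows "series_val r \<eta> \<in> places f"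
proof -
  have "series_val r \<eta> (cf_const c) = 0" if "c \<noteq> 0" for c
    using series_val_poly[of "[:c:]" 0] that
    by (simp add: cf_const_def curve_fps_def subst_fps_const)
  thus ?thesis
    unfolding places_def using assms series_val_mult series_val_add
    by (intro CollectI conjI allI impI exI[of _ g]) (simp_all add: series_val_def[of r \<eta> 0])
qed

end

section \<open>Places at affine points, unramified and ramified\<close>

definition point_sqrt :: "'k::field poly \<Rightarrow> 'k \<Rightarrow> 'k \<Rightarrow> 'k fps" where
  "point_sqrt f x1 y1 = fps_radical (\<lambda>_ _. y1) 2 (subst_fps [:x1, 1:] f)"

definition place_at :: "'k::field poly \<Rightarrow> 'k \<Rightarrow> 'k \<Rightarrow> 'k curve_fun \<Rightarrow> int" where
  "place_at f x1 y1 = series_val [:x1, 1:] (point_sqrt f x1 y1)"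

text \<open>The root selector passed to \<open>fps_radical\<close> is the constant
  \<open>y1\<close>, which picks the branch of y through (x1, y1) rather than its negative.\<close>

lemma point_sqrt_nth_0: "point_sqrt f x1 y1 $ 0 = y1"
  by (simp add: point_sqrt_def)

lemma point_sqrt_square:
  fixes f :: "'k::field_char_0 poly"
  assumes "poly f x1 = y1^2" and "y1 \<noteq> 0"
  shows "point_sqrt f x1 y1 ^ 2 = subst_fps [:x1, 1:] f"
  using power_radical[of "subst_fps [:x1, 1:] f" "\<lambda>_ _. y1" 1] assms
  by (simp add: point_sqrt_def subst_fps_nth_0 numeral_2_eq_2)

lemma series_param_point:
  fixes f :: "'k::field_char_0 poly"
  assumes "odd (Polynomial.degree f)" "poly f x1 = y1^2" "y1 \<noteq> 0"
  shows "series_param f [:x1, 1:] (point_sqrt f x1 y1)"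
  using assms by unfold_locales (simp_all add: point_sqrt_square)

lemma curve_fps_point_nth_0:
  "curve_fps [:x1, 1:] (point_sqrt f x1 y1) A B $ 0 = poly A x1 + poly B x1 * y1"
  by (simp add: curve_fps_def subst_fps_nth_0 point_sqrt_nth_0)

lemma subdegree_subst_fps_linear:
  "subdegree (subst_fps [:x1, 1:] [:- x0, 1:]) = (if x1 = x0 then 1 else 0)"
proof -
  have "subst_fps [:x1, 1:] [:- x0, 1:] = fps_of_poly [:x1 - x0, 1:]"
    by (simp add: subst_fps_def pcompose_pCons)
  thus ?thesis
    by (auto simp: subdegree_eq_0_iff)
qed

lemma place_at_linear:
  fixes f :: "'k::field_char_0 poly"
  assumes "odd (Polynomial.degree f)" "poly f x1 = y1^2" "y1 \<noteq> 0"
  shows "place_at f x1 y1 (to_fract [:- x0, 1:], 0) = (if x1 = x0 then 1 else 0)"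
proof -
  interpret series_param f "[:x1, 1:]" "point_sqrt f x1 y1"
    by (rule series_param_point[OF assms])
  show ?thesis
    using series_val_poly[of "[:- x0, 1:]" 0]
    by (simp add: place_at_def curve_fps_def subdegree_subst_fps_linear)
qed

lemma place_at_in_places:
  fixes f :: "'k::field_char_0 poly"
  assumes "odd (Polynomial.degree f)" "poly f x1 = y1^2" "y1 \<noteq> 0"
  shows "place_at f x1 y1 \<in> places f"
proof -
  interpret series_param f "[:x1, 1:]" "point_sqrt f x1 y1"
    by (rule series_param_point[OF assms])
  show ?thesis
    unfolding place_at_def
    by (rule series_val_place[of "(to_fract [:- x1, 1:], 0)"])
      (use place_at_linear[OF assms, of x1] in \<open>auto simp: place_at_def zero_prod_def\<close>)
qed

text \<open>The function y + y1 separates the two: it has the value 2 y1 at (x1, y1) and vanishes at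
  (x1, -y1).\<close>

lemma place_at_neq_conj:
  fixes f :: "'k::field_char_0 poly"
  assumes "odd (Polynomial.degree f)" "poly f x1 = y1^2" "y1 \<noteq> 0"
  shows "place_at f x1 y1 \<noteq> place_at f x1 (- y1)"
proof
  assume eq: "place_at f x1 y1 = place_at f x1 (- y1)"
  interpret P: series_param f "[:x1, 1:]" "point_sqrt f x1 y1"
    by (rule series_param_point[OF assms])
  interpret P': series_param f "[:x1, 1:]" "point_sqrt f x1 (- y1)"
    by (rule series_param_point) (use assms in auto)
  have "place_at f x1 y1 (to_fract [:y1:], to_fract 1) = 0"
    unfolding place_at_def using assms(3)
    by (subst P.series_val_poly) (auto simp: subdegree_eq_0_iff curve_fps_point_nth_0)
  moreover have "curve_fps [:x1, 1:] (point_sqrt f x1 (- y1)) [:y1:] 1 \<noteq> 0"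
    by (rule P'.curve_fps_nonzero) simp
  hence "place_at f x1 (- y1) (to_fract [:y1:], to_fract 1) \<noteq> 0"
    unfolding place_at_def
    by (subst P'.series_val_poly) (auto simp: subdegree_eq_0_iff curve_fps_point_nth_0)
  ultimately show False
    using eq by simp
qed

text \<open>At a root \<open>x1\<close> of \<open>f\<close> the local parameter is a square root t
  of x - x1. Writing f = (x - x1) h, one has y = t s with s^2 = h(x1 + t^2), and h(x1) is nonzero
  because the root is simple. Thus y has order 1.\<close>

lemma ramified_place:
  fixes f :: "'k::{field_char_0, alg_closed_field} poly"
  assumes odd: "odd (Polynomial.degree f)"
    and root: "poly f x1 = 0" and simple: "poly (pderiv f) x1 \<noteq> 0"
  obtains s where "s $ 0 \<noteq> 0" and "series_param f [:x1, 0, 1:] (fps_X * s)"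
    and "series_val [:x1, 0, 1:] (fps_X * s) \<in> places f"
proof -
  obtain h where h: "f = [:- x1, 1:] * h"
    using root by (auto simp: poly_eq_0_iff_dvd dvd_def)
  have hx1: "poly h x1 \<noteq> 0"
    using simple unfolding h pderiv_mult by (simp add: pderiv_pCons)
  obtain z where z: "z^2 = poly h x1"
    using nth_root_exists[of 2 "poly h x1"] by auto
  define r where "r = [:x1, 0, 1:]"
  define s where "s = fps_radical (\<lambda>_ _. z) 2 (subst_fps r h)"
  have h0: "subst_fps r h $ 0 = poly h x1"
    by (simp add: subst_fps_nth_0 r_def)
  have s2: "s^2 = subst_fps r h"
    using power_radical[of "subst_fps r h" "\<lambda>_ _. z" 1] z hx1 h0
    by (simp add: s_def numeral_2_eq_2)
  have s0: "s $ 0 \<noteq> 0"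
    using z hx1 by (auto simp: s_def)
  have "subst_fps r [:- x1, 1:] = fps_X^2"
    by (simp add: subst_fps_def r_def pcompose_pCons fps_of_poly_pCons power2_eq_square)
  hence "(fps_X * s)^2 = subst_fps r f"
    unfolding h subst_fps_mult by (simp add: s2 power_mult_distrib)
  hence sp: "series_param f r (fps_X * s)"
    using odd by unfold_locales (simp_all add: r_def)
  interpret series_param f r "fps_X * s"
    by (fact sp)
  have "s \<noteq> 0"
    using s0 by auto
  hence "subdegree (fps_X * s) = 1"
    using s0 by simp
  hence "series_val r (fps_X * s) (to_fract 0, to_fract 1) = 1"
    by (subst series_val_poly) (simp_all add: curve_fps_def)
  hence "series_val r (fps_X * s) \<in> places f"
    by (rule series_val_place[rotated]) (simp add: zero_prod_def)
  thus thesis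
    using that[OF s0] sp by (simp add: r_def)
qed

text \<open>A(x1 + t^2) is even in t, so the linear coefficient comes from the term B y
  alone.\<close>

lemma curve_fps_ramified_nth:
  "curve_fps [:x1, 0, 1:] (fps_X * s) A B $ 0 = poly A x1"
  "curve_fps [:x1, 0, 1:] (fps_X * s) A B $ 1 = poly B x1 * s $ 0"
proof -
  have "subst_fps [:x1, 0, 1:] A $ 1 = 0"
  proof -
    have "subst_fps [:x1, 0, 1:] A $ 1 = poly (pderiv (pcompose A [:x1, 0, 1:])) 0"
      by (simp add: subst_fps_def poly_0_coeff_0 coeff_pderiv)
    also have "\<dots> = 0"
      by (simp add: pderiv_pcompose pderiv_pCons)
    finally show ?thesis .
  qed
  thus "curve_fps [:x1, 0, 1:] (fps_X * s) A B $ 1 = poly B x1 * s $ 0"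
    by (simp add: curve_fps_def fps_mult_nth subst_fps_nth_0)
  show "curve_fps [:x1, 0, 1:] (fps_X * s) A B $ 0 = poly A x1"
    by (simp add: curve_fps_def subst_fps_nth_0)
qed

section \<open>Functions regular at all affine points\<close>

lemma poly_unique_root_power:
  fixes p :: "'k::alg_closed_field poly"
  assumes "p \<noteq> 0" and "\<And>x. x \<noteq> x0 \<Longrightarrow> poly p x \<noteq> 0"
  obtains c n where "c \<noteq> 0" and "p = smult c ([:- x0, 1:] ^ n)"
proof -
  obtain q where q: "p = [:- x0, 1:] ^ Polynomial.order x0 p * q" "\<not> [:- x0, 1:] dvd q"
    using order_decomp[OF assms(1)] by blast
  have "poly q x \<noteq> 0" for x
    using q(2) assms(2)[of x] arg_cong[OF q(1), of "\<lambda>p. poly p x"]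
    by (cases "x = x0") (auto simp: poly_eq_0_iff_dvd)
  hence "Polynomial.degree q = 0"
    using alg_closed_imp_poly_has_root by blast
  then obtain c where "q = [:c:]"
    by (rule degree_eq_zeroE)
  moreover from this have "c \<noteq> 0"
    using q(2) by auto
  ultimately show thesis
    using that[of c] q(1) by simp
qed

text \<open>This is integral closedness of k[x, y] for squarefree \<open>f\<close>: at a root of a
  denominator, regularity forces both numerators to vanish too, and the linear factor
  cancels.\<close>

lemma place_values_nonneg_imp_poly:
  fixes f :: "'k::{field_char_0, alg_closed_field} poly"
  assumes odd: "odd (Polynomial.degree f)"
    and simple: "\<And>x. poly f x = 0 \<Longrightarrow> poly (pderiv f) x \<noteq> 0"
    and g: "g \<noteq> 0"
    and unram: "\<And>x y. poly f x = y^2 \<Longrightarrow> y \<noteq> 0 \<Longrightarrow> place_at f x y g \<ge> 0"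
    and ram: "\<And>x s. poly f x = 0 \<Longrightarrow> s $ 0 \<noteq> 0 \<Longrightarrow> series_param f [:x, 0, 1:] (fps_X * s) \<Longrightarrow>
      series_val [:x, 0, 1:] (fps_X * s) \<in> places f \<Longrightarrow> series_val [:x, 0, 1:] (fps_X * s) g \<ge> 0"
  obtains A B where "g = (to_fract A, to_fract B)" and "A \<noteq> 0 \<or> B \<noteq> 0"
proof -
  \<comment> \<open>The common denominators of \<open>g\<close>; one of least degree turns out to
    have no root.\<close>
  define Q where "Q d \<longleftrightarrow> d \<noteq> 0 \<and> (\<exists>A B. g = (Fraction_Field.Fract A d, Fraction_Field.Fract B d))"
    for d
  have ex: "\<exists>d. Q d"
    unfolding Q_def using curve_fun_common_denominator[of g] by metis
  obtain d where Qd: "Q d" and min: "\<And>d'. Q d' \<Longrightarrow> Polynomial.degree d \<le> Polynomial.degree d'"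
    using ex by (metis exists_least_iff linorder_not_le[symmetric] arg_min_nat_lemma)
  obtain A B where AB: "d \<noteq> 0" "g = (Fraction_Field.Fract A d, Fraction_Field.Fract B d)"
    using Qd by (auto simp: Q_def)
  have nz: "A \<noteq> 0 \<or> B \<noteq> 0"
    using g AB by (auto simp: Fract_pair_eq_0_iff)
  have "poly d x1 \<noteq> 0" for x1
  proof
    assume root: "poly d x1 = 0"
    have "poly A x1 = 0 \<and> poly B x1 = 0"
    proof (cases "poly f x1 = 0")
      case True
      obtain s where s: "s $ 0 \<noteq> 0" "series_param f [:x1, 0, 1:] (fps_X * s)"
        "series_val [:x1, 0, 1:] (fps_X * s) \<in> places f"
        by (rule ramified_place[OF odd True simple[OF True]])
      interpret series_param f "[:x1, 0, 1:]" "fps_X * s"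
        by (fact s(2))
      have "series_val [:x1, 0, 1:] (fps_X * s) g \<ge> 0"
        by (rule ram[OF True s])
      hence "subdegree (curve_fps [:x1, 0, 1:] (fps_X * s) A B) \<ge> subdegree (subst_fps [:x1, 0, 1:] d)"
        unfolding AB(2) series_val_Fract[OF AB(1) nz] by simp
      \<comment> \<open>Since x - x1 becomes t^2, a root of \<open>d\<close> counts at least twice,
        and both lowest coefficients of A + B y must vanish.\<close>
      moreover have "subdegree (subst_fps [:x1, 0, 1:] d) \<ge> 2"
      proof (rule subdegree_geI)
        show "subst_fps [:x1, 0, 1:] d \<noteq> 0"
          using AB(1) by (simp add: subst_fps_eq_0_iff)
        fix i :: nat
        assume "i < 2"
        hence "i = 0 \<or> i = 1"
          by auto
        thus "subst_fps [:x1, 0, 1:] d $ i = 0"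
          using curve_fps_ramified_nth[of x1 s d 0] root by (auto simp: curve_fps_def)
      qed
      ultimately have "curve_fps [:x1, 0, 1:] (fps_X * s) A B $ 0 = 0"
        "curve_fps [:x1, 0, 1:] (fps_X * s) A B $ 1 = 0"
        by (auto intro!: nth_less_subdegree_zero)
      thus ?thesis
        using s(1) unfolding curve_fps_ramified_nth by simp
    next
      case False
      obtain y where y: "y^2 = poly f x1"
        using nth_root_exists[of 2 "poly f x1"] by auto
      \<comment> \<open>This applies to both points (x1, y) and (x1, -y); the two relations together
        give A(x1) = B(x1) = 0.\<close>
      have vanish: "poly A x1 + poly B x1 * z = 0" if z: "poly f x1 = z^2" "z \<noteq> 0" for z
      proof -
        interpret series_param f "[:x1, 1:]" "point_sqrt f x1 z"
          by (rule series_param_point[OF odd z])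
        have "subdegree (curve_fps [:x1, 1:] (point_sqrt f x1 z) A B) \<ge>
            subdegree (subst_fps [:x1, 1:] d)"
          using unram[OF z] unfolding place_at_def AB(2) series_val_Fract[OF AB(1) nz] by simp
        moreover have "subdegree (subst_fps [:x1, 1:] d) > 0"
          using AB(1) root by (auto simp: subdegree_eq_0_iff subst_fps_eq_0_iff subst_fps_nth_0
              intro!: Nat.gr0I)
        ultimately show ?thesis
          unfolding curve_fps_point_nth_0[of x1 f z A B, symmetric]
          by (intro nth_less_subdegree_zero) simp
      qed
      have "y \<noteq> 0"
        using y False by auto
      moreover have "poly A x1 + poly B x1 * y = 0" "poly A x1 + poly B x1 * (- y) = 0"
        using vanish[of y] vanish[of "- y"] y \<open>y \<noteq> 0\<close> by simp_all
      ultimately show ?thesis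
        by (auto simp: add_eq_0_iff)
    qed
    define T where "T = [:- x1, 1:]"
    obtain A' B' d' where fac: "A = T * A'" "B = T * B'" "d = T * d'"
      using \<open>poly A x1 = 0 \<and> poly B x1 = 0\<close> root
      unfolding poly_eq_0_iff_dvd dvd_def T_def[symmetric] by blast
    have T: "T \<noteq> 0" "d' \<noteq> 0"
      using AB(1) fac(3) by (auto simp: T_def)
    have "g = (Fraction_Field.Fract A' d', Fraction_Field.Fract B' d')"
      unfolding AB(2) fac using T by (simp add: eq_fract)
    hence "Q d'"
      unfolding Q_def using T(2) by blast
    moreover have "Polynomial.degree d = Suc (Polynomial.degree d')"
      unfolding fac(3) degree_mult_eq[OF T] by (simp add: T_def)
    ultimately show False
      using min[of d'] by simp
  qed
  hence "Polynomial.degree d = 0"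
    using alg_closed_imp_poly_has_root by blast
  then obtain c where c: "d = [:c:]"
    by (rule degree_eq_zeroE)
  have "g = (to_fract (smult (inverse c) A), to_fract (smult (inverse c) B))"
    using AB c by (simp add: to_fract_def eq_fract)
  thus thesis
    using that nz AB(1) c by (metis inverse_nonzero_iff_nonzero pCons_0_0 smult_eq_0_iff)
qed

text \<open>Clearing the pole at the conjugate point gives a function A + B y whose only affine zero
  is the given point, of order 2n. Its norm then has \<open>x0\<close> as its only possible root,
  and the order there determines the exponent.\<close>

lemma divisor_relation_imp_norm_eq:
  fixes f :: "'k::{field_char_0, alg_closed_field} poly"
  assumes odd: "odd (Polynomial.degree f)"
    and simple: "\<And>x. poly f x = 0 \<Longrightarrow> poly (pderiv f) x \<noteq> 0"
    and y0: "poly f x0 = y0^2" "y0 \<noteq> 0"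
    and g: "g \<noteq> 0" and n: "n > 0"
    and P: "place_at f x0 y0 g = int n" and P': "place_at f x0 (- y0) g = - int n"
    and other: "\<And>v. v \<in> places f \<Longrightarrow> v \<noteq> place_at f x0 y0 \<Longrightarrow> v \<noteq> place_at f x0 (- y0) \<Longrightarrow> v g = 0"
  shows "\<exists>A B c. A^2 - f * B^2 = smult c ([:- x0, 1:] ^ (2 * n)) \<and>
    poly A x0 + poly B x0 * y0 = 0 \<and> poly A x0 \<noteq> 0"
proof -
  define T where "T = [:- x0, 1:]"
  \<comment> \<open>Multiplying by (x - x0)^n cancels the pole at the conjugate point and raises the
    zero at the other from n to 2n.\<close>
  define h where "h = cf_mult f g (to_fract (T ^ n), 0)"
  have T: "T \<noteq> 0" "T ^ n \<noteq> 0"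
    by (simp_all add: T_def)
  have T': "(to_fract (T ^ n), to_fract 0) \<noteq> 0"
    using T by (simp add: zero_prod_def del: to_fract_0)
  have h0: "h \<noteq> 0"
    unfolding h_def using cf_mult_nonzero[OF odd g] T' by simp
  have h_point: "place_at f x y h = place_at f x y g + (if x = x0 then int n else 0)"
    if y: "poly f x = y^2" "y \<noteq> 0" for x y
  proof -
    interpret series_param f "[:x, 1:]" "point_sqrt f x y"
      by (rule series_param_point[OF odd y])
    have "subdegree (subst_fps [:x, 1:] (T ^ n)) = (if x = x0 then n else 0)"
      by (simp add: subst_fps_power T_def subdegree_subst_fps_linear)
    thus ?thesis
      unfolding h_def place_at_def using series_val_mult[OF g T'] series_val_poly[of "T ^ n" 0] T
      by (auto simp: curve_fps_def)
  qed
  have h_P: "place_at f x0 y0 h = 2 * int n" and h_P': "place_at f x0 (- y0) h = 0"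
    using h_point[of x0 y0] h_point[of x0 "- y0"] y0 P P' by auto
  have h_unram: "place_at f x y h = 0" if y: "poly f x = y^2" "y \<noteq> 0" and x: "x \<noteq> x0" for x y
  proof -
    \<comment> \<open>The function x - x0 has order 0 at this place and order 1 at the two points
      above \<open>x0\<close>, so the place differs from both.\<close>
    have "place_at f x y (to_fract T, 0) = 0" "place_at f x0 y0 (to_fract T, 0) = 1"
      "place_at f x0 (- y0) (to_fract T, 0) = 1"
      using place_at_linear[OF odd y, of x0] place_at_linear[OF odd y0, of x0]
        place_at_linear[OF odd, of x0 "- y0" x0] y0 x by (simp_all add: T_def)
    hence "place_at f x y g = 0"
      by (intro other place_at_in_places odd y) auto
    thus ?thesis
      using h_point[OF y] x by simp
  qed
  have h_ram: "series_val [:x, 0, 1:] (fps_X * s) h = 0"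
    if "poly f x = 0" and sp: "series_param f [:x, 0, 1:] (fps_X * s)"
      and pl: "series_val [:x, 0, 1:] (fps_X * s) \<in> places f" for x s
  proof -
    interpret series_param f "[:x, 0, 1:]" "fps_X * s"
      by (fact sp)
    have "x \<noteq> x0"
      using that y0 by auto
    hence "subst_fps [:x, 0, 1:] (T ^ k) $ 0 \<noteq> 0" for k
      by (simp add: subst_fps_nth_0 T_def)
    hence *: "series_val [:x, 0, 1:] (fps_X * s) (to_fract (T ^ k), to_fract 0) = 0" for k
      using T by (subst series_val_poly) (simp_all add: curve_fps_def)
    have "place_at f x0 y0 (to_fract T, to_fract 0) = 1"
      "place_at f x0 (- y0) (to_fract T, to_fract 0) = 1"
      using place_at_linear[OF odd y0, of x0] place_at_linear[OF odd, of x0 "- y0" x0] y0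
      by (simp_all add: T_def)
    hence "series_val [:x, 0, 1:] (fps_X * s) g = 0"
      using *[of 1] by (intro other pl) auto
    thus ?thesis
      unfolding h_def using series_val_mult[OF g T'] *[of n] by simp
  qed
  have "place_at f x y h \<ge> 0" if y: "poly f x = y^2" "y \<noteq> 0" for x y
  proof (cases "x = x0")
    case True
    hence "y = y0 \<or> y = - y0"
      using y y0 True by (metis power2_eq_iff)
    thus ?thesis
      using True h_P h_P' by auto
  qed (use h_unram[OF y] in simp)
  then obtain A B where AB: "h = (to_fract A, to_fract B)" and nz: "A \<noteq> 0 \<or> B \<noteq> 0"
    using place_values_nonneg_imp_poly[OF odd simple h0] h_ram by (metis order_refl)
  have val_point: "place_at f x y h =
      int (subdegree (curve_fps [:x, 1:] (point_sqrt f x y) A B))"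
    and nz_point: "curve_fps [:x, 1:] (point_sqrt f x y) A B \<noteq> 0"
    if y: "poly f x = y^2" "y \<noteq> 0" for x y
  proof -
    interpret series_param f "[:x, 1:]" "point_sqrt f x y"
      by (rule series_param_point[OF odd y])
    show "place_at f x y h = int (subdegree (curve_fps [:x, 1:] (point_sqrt f x y) A B))"
      unfolding AB place_at_def by (rule series_val_poly[OF nz])
    show "curve_fps [:x, 1:] (point_sqrt f x y) A B \<noteq> 0"
      by (rule curve_fps_nonzero[OF nz])
  qed
  define N where "N = A^2 - f * B^2"
  have N0: "N \<noteq> 0"
    using odd_degree_norm(3)[OF odd, of A B] nz by (auto simp: N_def)
  \<comment> \<open>A root of the norm other than \<open>x0\<close> would give a zero of
    \<open>h\<close> at some point above it.\<close>
  have "poly N x \<noteq> 0" if x: "x \<noteq> x0" for x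
  proof (cases "poly f x = 0")
    case True
    obtain s where s: "s $ 0 \<noteq> 0" "series_param f [:x, 0, 1:] (fps_X * s)"
      "series_val [:x, 0, 1:] (fps_X * s) \<in> places f"
      by (rule ramified_place[OF odd True simple[OF True]])
    interpret series_param f "[:x, 0, 1:]" "fps_X * s"
      by (fact s(2))
    have "subdegree (curve_fps [:x, 0, 1:] (fps_X * s) A B) = 0"
      using h_ram[OF True s(2,3)] series_val_poly[OF nz] by (simp add: AB)
    hence "curve_fps [:x, 0, 1:] (fps_X * s) A B $ 0 \<noteq> 0"
      using curve_fps_nonzero[OF nz] by (simp add: subdegree_eq_0_iff)
    thus ?thesis
      using True by (simp add: curve_fps_ramified_nth N_def)
  next
    case False
    obtain y where y: "y^2 = poly f x"
      using nth_root_exists[of 2 "poly f x"] by auto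
    have nzero: "poly A x + poly B x * z \<noteq> 0" if z: "poly f x = z^2" "z \<noteq> 0" for z
      using val_point[OF z] nz_point[OF z] h_unram[OF z x]
      by (simp add: subdegree_eq_0_iff curve_fps_point_nth_0)
    have "poly N x = (poly A x + poly B x * y) * (poly A x + poly B x * (- y))"
      unfolding N_def by (simp add: y[symmetric] algebra_simps power2_eq_square)
    thus ?thesis
      using nzero[of y] nzero[of "- y"] y False by (metis mult_eq_0_iff neg_equal_0_iff_equal
          power2_minus zero_power2)
  qed
  then obtain c k where ck: "c \<noteq> 0" "N = smult c (T ^ k)"
    using poly_unique_root_power[OF N0, of x0] unfolding T_def by metis
  have P'nz: "poly A x0 - poly B x0 * y0 \<noteq> 0"
    using val_point[of x0 "- y0"] nz_point[of x0 "- y0"] h_P' y0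
    by (simp add: subdegree_eq_0_iff curve_fps_point_nth_0)
  have sub: "subdegree (curve_fps [:x0, 1:] (point_sqrt f x0 y0) A B) = 2 * n"
    using val_point[OF y0] h_P by linarith
  hence "curve_fps [:x0, 1:] (point_sqrt f x0 y0) A B $ 0 = 0"
    using n by (intro nth_less_subdegree_zero) simp
  hence Pz: "poly A x0 + poly B x0 * y0 = 0"
    by (simp add: curve_fps_point_nth_0)
  interpret series_param f "[:x0, 1:]" "point_sqrt f x0 y0"
    by (rule series_param_point[OF odd y0])
  \<comment> \<open>The conjugate A - B y is a unit at (x0, y0), so the norm has there the same
    order 2n as A + B y.\<close>
  have nz1: "curve_fps [:x0, 1:] (point_sqrt f x0 y0) A (- B) $ 0 \<noteq> 0"
    using P'nz by (simp add: curve_fps_point_nth_0)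
  hence "subdegree (subst_fps [:x0, 1:] N) = 2 * n"
    unfolding N_def curve_fps_conj[symmetric] using sub nz_point[OF y0]
    by (subst subdegree_mult) auto
  moreover have "subdegree (subst_fps [:x0, 1:] N) = k"
  proof -
    have "N = [:c:] * T ^ k"
      using ck by simp
    thus ?thesis
      using ck(1) T
      by (simp add: subst_fps_mult subst_fps_const subst_fps_power T_def subdegree_subst_fps_linear
          subst_fps_eq_0_iff del: mult_pCons_left)
  qed
  ultimately have "k = 2 * n"
    by simp
  moreover have "poly A x0 \<noteq> 0"
    using Pz P'nz by auto
  ultimately show ?thesis
    using ck Pz unfolding N_def T_def by blast
qed

section \<open>Principal divisors\<close>

lemma places_mult: "v \<in> places f \<Longrightarrow> g \<noteq> 0 \<Longrightarrow> h \<noteq> 0 \<Longrightarrow> v (cf_mult f g h) = v g + v h"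
  unfolding places_def by blast

lemma places_const: "v \<in> places f \<Longrightarrow> c \<noteq> 0 \<Longrightarrow> v (cf_const c) = 0"
  by (simp add: places_def)

text \<open>The inverse is the conjugate divided by the norm.\<close>

lemma cf_inverse_exists:
  assumes odd: "odd (Polynomial.degree f)" and g: "g \<noteq> 0"
  obtains h where "h \<noteq> 0" and "cf_mult f g h = cf_const 1"
proof -
  define N where "N = fst g * fst g - to_fract f * snd g * snd g"
  have "(fst g, - snd g) \<noteq> 0"
    using g by (cases g) (auto simp: zero_prod_def)
  hence "cf_mult f g (fst g, - snd g) \<noteq> 0"
    by (rule cf_mult_nonzero[OF odd g])
  hence N: "N \<noteq> 0"
    by (auto simp: cf_mult_def N_def zero_prod_def)
  define h where "h = (fst g / N, - snd g / N)"
  have "cf_mult f g h = cf_const 1"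
  proof -
    have "fst (cf_mult f g h) = (fst g * fst g - to_fract f * snd g * snd g) / N"
      by (simp add: cf_mult_def h_def diff_divide_distrib)
    hence "fst (cf_mult f g h) = N / N"
      by (simp add: N_def)
    moreover have "snd (cf_mult f g h) = 0"
      by (simp add: cf_mult_def h_def)
    ultimately show ?thesis
      using N by (simp add: prod_eq_iff cf_const_def flip: one_pCons)
  qed
  moreover have "h \<noteq> 0"
    using g N by (cases g) (auto simp: h_def zero_prod_def)
  ultimately show thesis
    using that by blast
qed

lemma principal_divisors_subgroup:
  assumes odd: "odd (Polynomial.degree f)"
  shows "subgroup (principal_divisors f) (Div f)"
proof
  show "principal_divisors f \<subseteq> carrier (Div f)"
    by (auto simp: principal_divisors_def)
next
  fix D E
  assume D: "D \<in> principal_divisors f" and E: "E \<in> principal_divisors f"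
  obtain g where g: "g \<noteq> 0" "\<forall>v\<in>places f. Poly_Mapping.lookup D v = v g"
    using D by (auto simp: principal_divisors_def)
  obtain h where h: "h \<noteq> 0" "\<forall>v\<in>places f. Poly_Mapping.lookup E v = v h"
    using E by (auto simp: principal_divisors_def)
  have "D + E \<in> carrier (Div f)"
    using D E keys_add[of D E] by (auto simp: principal_divisors_def)
  moreover have "cf_mult f g h \<noteq> 0"
    using cf_mult_nonzero[OF odd g(1) h(1)] .
  moreover have "\<forall>v\<in>places f. Poly_Mapping.lookup (D + E) v = v (cf_mult f g h)"
    using g h by (simp add: lookup_add places_mult)
  ultimately show "D \<otimes>\<^bsub>Div f\<^esub> E \<in> principal_divisors f"
    unfolding principal_divisors_def mult_free_Abelian_group by blast
next
  have "cf_const 1 \<noteq> 0"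
    by (simp add: cf_const_def zero_prod_def)
  moreover have "\<forall>v\<in>places f. Poly_Mapping.lookup (0 :: _ \<Rightarrow>\<^sub>0 int) v = v (cf_const 1)"
    by (simp add: places_const)
  moreover have "0 \<in> carrier (Div f)"
    by simp
  ultimately show "\<one>\<^bsub>Div f\<^esub> \<in> principal_divisors f"
    unfolding principal_divisors_def one_free_Abelian_group by blast
next
  fix D
  assume D: "D \<in> principal_divisors f"
  obtain g where g: "g \<noteq> 0" "\<forall>v\<in>places f. Poly_Mapping.lookup D v = v g"
    using D by (auto simp: principal_divisors_def)
  obtain h where h: "h \<noteq> 0" "cf_mult f g h = cf_const 1"
    by (rule cf_inverse_exists[OF odd g(1)])
  have "v g + v h = 0" if "v \<in> places f" for v
    using places_mult[OF that g(1) h(1)] places_const[OF that, of 1] h(2) by simp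
  hence "\<forall>v\<in>places f. Poly_Mapping.lookup (- D) v = v h"
    using g(2) by (simp add: add_eq_0_iff)
  moreover have "- D \<in> carrier (Div f)" "inv\<^bsub>Div f\<^esub> D = - D"
    using D by (simp_all add: principal_divisors_def)
  ultimately show "inv\<^bsub>Div f\<^esub> D \<in> principal_divisors f"
    unfolding principal_divisors_def using h(1) by (intro CollectI conjI exI[of _ h]) simp_all
qed

lemma principal_divisors_normal:
  "odd (Polynomial.degree f) \<Longrightarrow> principal_divisors f \<lhd> Div f"
  by (rule comm_group.subgroup_imp_normal[OF abelian_free_Abelian_group principal_divisors_subgroup])

lemma r_coset_Div: "H #>\<^bsub>Div f\<^esub> E = (\<lambda>D. D + E) ` H"
  by (auto simp: r_coset_def)

text \<open>Restricting the carrier in \<open>Pic0\<close> and \<open>jacobian_points\<close> leaves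
  the operation unchanged, so powers are those of cosets in the quotient of
  \<open>Div\<close>.\<close>

lemma jacobian_points_pow:
  fixes f :: "'a::field poly"
  assumes odd: "odd (Polynomial.degree f)" and E: "E \<in> carrier (Div (ac_poly f))"
  shows "(principal_divisors (ac_poly f) #>\<^bsub>Div (ac_poly f)\<^esub> E) [^]\<^bsub>jacobian_points f\<^esub> (n::nat) =
    principal_divisors (ac_poly f) #>\<^bsub>Div (ac_poly f)\<^esub> (frag_cmul (int n) E)"
proof -
  have odd': "odd (Polynomial.degree (ac_poly f))"
    using odd by (simp add: degree_ac_poly)
  interpret normal "principal_divisors (ac_poly f)" "Div (ac_poly f)"
    by (rule principal_divisors_normal[OF odd'])
  show ?thesis
  proof (induction n)
    case 0
    show ?case
      by (simp add: r_coset_Div jacobian_points_def Pic0_def nat_pow_def)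
  next
    case (Suc n)
    have nE: "frag_cmul (int n) E \<in> carrier (Div (ac_poly f))"
      using E keys_cmul[of "int n" E] by auto
    have "(principal_divisors (ac_poly f) #>\<^bsub>Div (ac_poly f)\<^esub> (frag_cmul (int n) E))
        \<otimes>\<^bsub>jacobian_points f\<^esub> (principal_divisors (ac_poly f) #>\<^bsub>Div (ac_poly f)\<^esub> E) =
      principal_divisors (ac_poly f) #>\<^bsub>Div (ac_poly f)\<^esub> (frag_cmul (int (Suc n)) E)"
      using rcos_sum[OF nE E]
      by (simp add: jacobian_points_def Pic0_def frag_cmul_distrib add.commute)
    with Suc.IH show ?case
      by (simp add: nat_pow_def)
  qed
qed

section \<open>The Galois action\<close>

locale galois_automorphism =
  fixes \<sigma> :: "'a::field alg_closure \<Rightarrow> 'a alg_closure"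
  assumes sigma: "\<sigma> \<in> galois_group"
begin

lemma sigma_add: "\<sigma> (x + y) = \<sigma> x + \<sigma> y" and sigma_mult: "\<sigma> (x * y) = \<sigma> x * \<sigma> y"
  and sigma_to_ac: "\<sigma> (to_ac c) = to_ac c" and bij_sigma: "bij \<sigma>"
  using sigma by (auto simp: galois_group_def)

lemma sigma_0: "\<sigma> 0 = 0" and sigma_1: "\<sigma> 1 = 1"
  using sigma_to_ac[of 0] sigma_to_ac[of 1] by simp_all

lemma sigma_eq_iff: "\<sigma> x = \<sigma> y \<longleftrightarrow> x = y"
  using bij_sigma by (auto simp: bij_def inj_eq)

lemma sigma_eq_0_iff: "\<sigma> x = 0 \<longleftrightarrow> x = 0"
  using sigma_eq_iff[of x 0] by (simp add: sigma_0)

lemma sigma_sum: "\<sigma> (\<Sum>x\<in>A. g x) = (\<Sum>x\<in>A. \<sigma> (g x))"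
  by (induction A rule: infinite_finite_induct) (auto simp: sigma_add sigma_0)

lemma inv_sigma: "inv_into UNIV \<sigma> \<in> galois_group"
proof -
  have e: "\<sigma> (inv_into UNIV \<sigma> x) = x" for x
    using bij_sigma by (simp add: bij_def surj_f_inv_f)
  show ?thesis
    unfolding galois_group_def
    by (intro CollectI conjI allI bij_imp_bij_inv bij_sigma; subst sigma_eq_iff[symmetric])
      (simp_all add: e sigma_add sigma_mult sigma_to_ac)
qed

lemma map_sigma_add: "map_poly \<sigma> (p + q) = map_poly \<sigma> p + map_poly \<sigma> q"
  by (rule poly_eqI) (simp add: coeff_map_poly sigma_0 sigma_add)

lemma map_sigma_mult: "map_poly \<sigma> (p * q) = map_poly \<sigma> p * map_poly \<sigma> q"
  by (rule poly_eqI) (simp add: coeff_map_poly sigma_0 Polynomial.coeff_mult sigma_sum sigma_mult)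

lemma map_sigma_eq_0_iff: "map_poly \<sigma> p = 0 \<longleftrightarrow> p = 0"
  by (simp add: map_poly_eq_0_iff sigma_0 sigma_eq_0_iff)

lemma map_sigma_ac_poly: "map_poly \<sigma> (ac_poly p) = ac_poly p"
  by (rule poly_eqI) (simp add: coeff_map_poly sigma_0 sigma_to_ac)

lemma map_sigma_pcompose: "map_poly \<sigma> (pcompose p q) = pcompose (map_poly \<sigma> p) (map_poly \<sigma> q)"
  by (induction p) (simp_all add: pcompose_pCons map_poly_pCons map_sigma_add map_sigma_mult sigma_0)

lemma galois_fun_Fract:
  "d \<noteq> 0 \<Longrightarrow> galois_fun \<sigma> (Fraction_Field.Fract A d, Fraction_Field.Fract B d) =
    (Fraction_Field.Fract (map_poly \<sigma> A) (map_poly \<sigma> d),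
     Fraction_Field.Fract (map_poly \<sigma> B) (map_poly \<sigma> d))"
  by (simp add: galois_fun_def map_ratfun_Fract[OF sigma])

lemma galois_fun_eq_0_iff: "galois_fun \<sigma> g = 0 \<longleftrightarrow> g = 0"
proof -
  obtain A B d where g: "d \<noteq> 0" "g = (Fraction_Field.Fract A d, Fraction_Field.Fract B d)"
    by (rule curve_fun_common_denominator)
  show ?thesis
    using g by (simp add: galois_fun_Fract Fract_pair_eq_0_iff map_sigma_eq_0_iff)
qed

lemma galois_fun_add: "galois_fun \<sigma> (g + h) = galois_fun \<sigma> g + galois_fun \<sigma> h"
proof -
  obtain A B d where g: "d \<noteq> 0" "g = (Fraction_Field.Fract A d, Fraction_Field.Fract B d)"
    by (rule curve_fun_common_denominator)
  obtain A' B' d' where h: "d' \<noteq> 0" "h = (Fraction_Field.Fract A' d', Fraction_Field.Fract B' d')"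
    by (rule curve_fun_common_denominator)
  show ?thesis
    using g h by (simp add: galois_fun_Fract map_sigma_eq_0_iff map_sigma_add map_sigma_mult)
qed

lemma galois_fun_mult:
  "galois_fun \<sigma> (cf_mult (ac_poly f) g h) = cf_mult (ac_poly f) (galois_fun \<sigma> g) (galois_fun \<sigma> h)"
proof -
  obtain A B d where g: "d \<noteq> 0" "g = (Fraction_Field.Fract A d, Fraction_Field.Fract B d)"
    by (rule curve_fun_common_denominator)
  obtain A' B' d' where h: "d' \<noteq> 0" "h = (Fraction_Field.Fract A' d', Fraction_Field.Fract B' d')"
    by (rule curve_fun_common_denominator)
  show ?thesis
    using g h by (simp add: galois_fun_Fract cf_mult_Fract map_sigma_eq_0_iff map_sigma_add
        map_sigma_mult map_sigma_ac_poly)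
qed

lemma galois_fun_const: "galois_fun \<sigma> (cf_const c) = cf_const (\<sigma> c)"
  using galois_fun_Fract[of 1 "[:c:]" 0]
  by (simp add: cf_const_def to_fract_def map_poly_pCons sigma_0 sigma_1 Zero_fract_def[symmetric])

lemma galois_fun_inverse: "galois_fun \<sigma> (galois_fun (inv_into UNIV \<sigma>) g) = g"
proof -
  interpret i: galois_automorphism "inv_into UNIV \<sigma>"
    by unfold_locales (rule inv_sigma)
  obtain A B d where g: "d \<noteq> 0" "g = (Fraction_Field.Fract A d, Fraction_Field.Fract B d)"
    by (rule curve_fun_common_denominator)
  have "map_poly \<sigma> (map_poly (inv_into UNIV \<sigma>) p) = p" for p
    using bij_sigma
    by (intro poly_eqI) (simp add: coeff_map_poly sigma_0 i.sigma_0 bij_def surj_f_inv_f)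
  thus ?thesis
    using g by (simp add: galois_fun_Fract i.galois_fun_Fract i.map_sigma_eq_0_iff)
qed

lemma comp_galois_fun_place:
  assumes v: "v \<in> places (ac_poly f)"
  shows "v \<circ> galois_fun \<sigma> \<in> places (ac_poly f)"
proof -
  obtain g where g: "g \<noteq> 0" "v g = 1"
    using v by (auto simp: places_def)
  \<comment> \<open>A function of value 1 for the new place is the preimage under \<sigma> of one
    for \<open>v\<close>.\<close>
  have "galois_fun (inv_into UNIV \<sigma>) g \<noteq> 0 \<and> (v \<circ> galois_fun \<sigma>) (galois_fun (inv_into UNIV \<sigma>) g) = 1"
    using g by (auto simp: galois_fun_inverse) (metis galois_fun_eq_0_iff galois_fun_inverse)
  moreover have "(v \<circ> galois_fun \<sigma>) 0 = 0"
    using v galois_fun_eq_0_iff[of 0] by (simp add: places_def)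
  moreover have "(v \<circ> galois_fun \<sigma>) (g + h) \<ge> min ((v \<circ> galois_fun \<sigma>) g) ((v \<circ> galois_fun \<sigma>) h)"
    if "g \<noteq> 0" "h \<noteq> 0" "g + h \<noteq> 0" for g h
  proof -
    have "galois_fun \<sigma> g \<noteq> 0" "galois_fun \<sigma> h \<noteq> 0" "galois_fun \<sigma> g + galois_fun \<sigma> h \<noteq> 0"
      using that by (simp_all add: galois_fun_eq_0_iff flip: galois_fun_add)
    thus ?thesis
      using v unfolding places_def comp_def galois_fun_add by blast
  qed
  ultimately show ?thesis
    unfolding places_def
    by (intro CollectI conjI allI impI exI[of _ "galois_fun (inv_into UNIV \<sigma>) g"])
      (simp_all add: galois_fun_mult galois_fun_eq_0_iff places_mult[OF v] galois_fun_const
        places_const[OF v] sigma_eq_0_iff)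
qed

end

lemma inv_into_galois:
  assumes "\<sigma> \<in> galois_group"
  shows "inv_into UNIV (inv_into UNIV \<sigma>) = \<sigma>"
  using assms by (simp add: galois_group_def inv_inv_eq)

lemma galois_place_inverse:
  assumes "\<sigma> \<in> galois_group"
  shows "galois_place \<sigma> (galois_place (inv_into UNIV \<sigma>) v) = v"
    and "galois_place (inv_into UNIV \<sigma>) (galois_place \<sigma> v) = v"
proof -
  interpret galois_automorphism \<sigma>
    by unfold_locales (rule assms)
  interpret i: galois_automorphism "inv_into UNIV \<sigma>"
    by unfold_locales (rule inv_sigma)
  show "galois_place \<sigma> (galois_place (inv_into UNIV \<sigma>) v) = v"
    "galois_place (inv_into UNIV \<sigma>) (galois_place \<sigma> v) = v"
    using galois_fun_inverse i.galois_fun_inverse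
    by (auto simp: galois_place_def inv_into_galois[OF assms])
qed

lemma galois_place_in_places:
  assumes "\<sigma> \<in> galois_group" and "v \<in> places (ac_poly f)"
  shows "galois_place \<sigma> v \<in> places (ac_poly f)"
proof -
  interpret galois_automorphism "inv_into UNIV \<sigma>"
    by unfold_locales (rule galois_automorphism.inv_sigma[OF galois_automorphism.intro[OF assms(1)]])
  show ?thesis
    unfolding galois_place_def by (rule comp_galois_fun_place[OF assms(2)])
qed

text \<open>Both sides are additive in \<open>D\<close>, so generators suffice; there it is the
  bijectivity of \<open>galois_place\<close>.\<close>

lemma lookup_galois_div:
  assumes "\<sigma> \<in> galois_group"
  shows "Poly_Mapping.lookup (galois_div \<sigma> D) w =
    Poly_Mapping.lookup D (galois_place (inv_into UNIV \<sigma>) w)"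
proof -
  have "Poly_Mapping.keys D \<subseteq> UNIV"
    by simp
  thus ?thesis
  proof (induction D rule: frag_induction)
    case (one v)
    have "w = galois_place \<sigma> v \<longleftrightarrow> galois_place (inv_into UNIV \<sigma>) w = v"
      using galois_place_inverse[OF assms] by metis
    thus ?case
      by (simp add: galois_div_def)
  next
    case (diff D E)
    thus ?case
      by (simp add: galois_div_def frag_extend_diff lookup_minus)
  qed (simp add: galois_div_def)
qed

text \<open>If \<open>D\<close> is the divisor of \<open>g\<close>, its conjugate is the divisor of
  \<open>galois_fun \<sigma> g\<close>.\<close>

lemma galois_div_principal:
  assumes s: "\<sigma> \<in> galois_group" and D: "D \<in> principal_divisors (ac_poly f)"
  shows "galois_div \<sigma> D \<in> principal_divisors (ac_poly f)"
proof -
  interpret galois_automorphism \<sigma>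
    by unfold_locales (rule s)
  obtain g where g: "g \<noteq> 0" "\<forall>v\<in>places (ac_poly f). Poly_Mapping.lookup D v = v g"
    using D by (auto simp: principal_divisors_def)
  have "galois_fun \<sigma> g \<noteq> 0"
    using g by (simp add: galois_fun_eq_0_iff)
  moreover have "Poly_Mapping.lookup (galois_div \<sigma> D) w = w (galois_fun \<sigma> g)"
    if w: "w \<in> places (ac_poly f)" for w
  proof -
    have "galois_place (inv_into UNIV \<sigma>) w \<in> places (ac_poly f)"
      by (rule galois_place_in_places[OF inv_sigma w])
    hence "Poly_Mapping.lookup (galois_div \<sigma> D) w = galois_place (inv_into UNIV \<sigma>) w g"
      using g(2) by (simp add: lookup_galois_div[OF s])
    thus ?thesis
      by (simp add: galois_place_def inv_into_galois[OF s])
  qed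
  moreover have "Poly_Mapping.keys (galois_div \<sigma> D) \<subseteq> places (ac_poly f)"
  proof
    fix w
    assume "w \<in> Poly_Mapping.keys (galois_div \<sigma> D)"
    hence "galois_place (inv_into UNIV \<sigma>) w \<in> Poly_Mapping.keys D"
      by (simp add: in_keys_iff lookup_galois_div[OF s])
    hence "galois_place (inv_into UNIV \<sigma>) w \<in> places (ac_poly f)"
      using D by (auto simp: principal_divisors_def)
    thus "w \<in> places (ac_poly f)"
      using galois_place_in_places[OF s] galois_place_inverse(1)[OF s, of w] by metis
  qed
  ultimately show ?thesis
    unfolding principal_divisors_def by (intro CollectI conjI exI[of _ "galois_fun \<sigma> g"]) simp_all
qed

lemma galois_div_principal_image:
  assumes s: "\<sigma> \<in> galois_group"
  shows "galois_div \<sigma> ` principal_divisors (ac_poly f) = principal_divisors (ac_poly f)"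
proof
  interpret galois_automorphism \<sigma>
    by unfold_locales (rule s)
  show "galois_div \<sigma> ` principal_divisors (ac_poly f) \<subseteq> principal_divisors (ac_poly f)"
    using galois_div_principal[OF s] by blast
  show "principal_divisors (ac_poly f) \<subseteq> galois_div \<sigma> ` principal_divisors (ac_poly f)"
  proof
    fix D
    assume "D \<in> principal_divisors (ac_poly f)"
    hence "galois_div (inv_into UNIV \<sigma>) D \<in> principal_divisors (ac_poly f)"
      by (rule galois_div_principal[OF inv_sigma])
    moreover have "galois_div \<sigma> (galois_div (inv_into UNIV \<sigma>) D) = D"
      by (rule poly_mapping_eqI)
        (simp add: lookup_galois_div s inv_sigma inv_into_galois galois_place_inverse)
    ultimately show "D \<in> galois_div \<sigma> ` principal_divisors (ac_poly f)"
      by (metis image_eqI)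
  qed
qed

lemma galois_div_coset:
  assumes s: "\<sigma> \<in> galois_group" and E: "galois_div \<sigma> E = E"
  shows "galois_div \<sigma> ` (principal_divisors (ac_poly f) #>\<^bsub>Div (ac_poly f)\<^esub> E) =
    principal_divisors (ac_poly f) #>\<^bsub>Div (ac_poly f)\<^esub> E"
proof -
  have "galois_div \<sigma> (D + E) = galois_div \<sigma> D + E" for D
    using E by (simp add: galois_div_def frag_extend_add)
  hence "galois_div \<sigma> ` (principal_divisors (ac_poly f) #>\<^bsub>Div (ac_poly f)\<^esub> E) =
      (\<lambda>D. D + E) ` (galois_div \<sigma> ` principal_divisors (ac_poly f))"
    by (simp add: r_coset_Div image_image)
  thus ?thesis
    by (simp add: galois_div_principal_image[OF s] r_coset_Div)
qed

text \<open>
  An automorphism maps the square root of \<open>f\<close> in \<open>K[[x - x0]]\<close> to one with the same constant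
  term, hence fixes it.
\<close>

lemma place_at_galois_fun:
  fixes f :: "'a::field_char_0 poly"
  assumes s: "\<sigma> \<in> galois_group"
    and odd: "odd (Polynomial.degree f)" and y0: "poly f x0 = y0^2" "y0 \<noteq> 0"
  shows "place_at (ac_poly f) (to_ac x0) (to_ac y0) \<circ> galois_fun \<sigma> =
    place_at (ac_poly f) (to_ac x0) (to_ac y0)"
proof
  fix g
  interpret galois_automorphism \<sigma>
    by unfold_locales (rule s)
  define \<eta> where "\<eta> = point_sqrt (ac_poly f) (to_ac x0) (to_ac y0)"
  define r where "r = [:to_ac x0, 1:]"
  have odd': "odd (Polynomial.degree (ac_poly f))"
    using odd by (simp add: degree_ac_poly)
  have y0': "poly (ac_poly f) (to_ac x0) = (to_ac y0)^2" "to_ac y0 \<noteq> 0"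
    using y0 by (simp_all add: poly_ac_poly)
  interpret series_param "ac_poly f" r \<eta>
    unfolding r_def \<eta>_def by (rule series_param_point[OF odd' y0'])
  \<comment> \<open>The coefficientwise action on power series in t; it is compatible with the
    substitution because \<open>r\<close> has rational coefficients.\<close>
  define S where "S a = Abs_fps (\<lambda>n. \<sigma> (a $ n))" for a
  have S_add: "S (a + b) = S a + S b" for a b
    by (rule fps_ext) (simp add: S_def sigma_add)
  have S_mult: "S (a * b) = S a * S b" for a b
    by (rule fps_ext) (simp add: S_def fps_mult_nth sigma_sum sigma_mult)
  have S_eq_0: "S a = 0 \<longleftrightarrow> a = 0" for a
    by (simp add: S_def fps_eq_iff sigma_eq_0_iff)
  have S_subdegree: "subdegree (S a) = subdegree a" for a
  proof (cases "a = 0")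
    case False
    thus ?thesis
      by (intro subdegreeI) (auto simp: S_def sigma_eq_0_iff)
  qed (use S_eq_0[of 0] in simp)
  have map_r: "map_poly \<sigma> r = r"
    by (simp add: r_def map_poly_pCons sigma_0 sigma_1 sigma_to_ac)
  have S_subst: "S (subst_fps r p) = subst_fps r (map_poly \<sigma> p)" for p
    by (rule fps_ext)
      (simp add: S_def subst_fps_def coeff_map_poly sigma_0 map_r
        flip: map_sigma_pcompose[of p r, unfolded map_r])
  have S_eta: "S \<eta> = \<eta>"
  proof -
    have "(S \<eta>)^2 = \<eta>^2"
      unfolding power2_eq_square S_mult[symmetric]
      by (simp add: power2_eq_square[symmetric] eta_square S_subst map_sigma_ac_poly)
    hence "S \<eta> = \<eta> \<or> S \<eta> = - \<eta>"
      by (simp add: power2_eq_iff)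
    moreover have "S \<eta> $ 0 = to_ac y0" "(- \<eta>) $ 0 = - to_ac y0"
      by (simp_all add: S_def \<eta>_def point_sqrt_nth_0 sigma_to_ac)
    hence "S \<eta> \<noteq> - \<eta>"
      using y0'(2) by auto
    ultimately show ?thesis
      by simp
  qed
  have S_curve: "S (curve_fps r \<eta> A B) = curve_fps r \<eta> (map_poly \<sigma> A) (map_poly \<sigma> B)" for A B
    by (simp add: curve_fps_def S_add S_mult S_subst S_eta)
  show "(place_at (ac_poly f) (to_ac x0) (to_ac y0) \<circ> galois_fun \<sigma>) g =
    place_at (ac_poly f) (to_ac x0) (to_ac y0) g"
  proof (cases "g = 0")
    case True
    thus ?thesis
      using galois_fun_eq_0_iff[of 0] by simp
  next
    case False
    obtain A B d where g: "d \<noteq> 0" "g = (Fraction_Field.Fract A d, Fraction_Field.Fract B d)"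
      by (rule curve_fun_common_denominator)
    have nz: "A \<noteq> 0 \<or> B \<noteq> 0"
      using g False by (auto simp: Fract_pair_eq_0_iff)
    have "series_val r \<eta> (galois_fun \<sigma> g) = series_val r \<eta> g"
      using g nz by (simp add: galois_fun_Fract series_val_Fract map_sigma_eq_0_iff
          S_subdegree flip: S_curve S_subst)
    thus ?thesis
      by (simp add: place_at_def \<eta>_def r_def)
  qed
qed

lemma galois_place_place_at:
  fixes f :: "'a::field_char_0 poly"
  assumes "\<sigma> \<in> galois_group" "odd (Polynomial.degree f)" "poly f x0 = y0^2" "y0 \<noteq> 0"
  shows "galois_place \<sigma> (place_at (ac_poly f) (to_ac x0) (to_ac y0)) =
    place_at (ac_poly f) (to_ac x0) (to_ac y0)"
  unfolding galois_place_def
  by (rule place_at_galois_fun[OF galois_automorphism.inv_sigma[OF galois_automorphism.intro]])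
    (use assms in auto)

text \<open>Reduces positive rank to polynomials over the ground field: a torsion relation for the
  class of P - P' yields a norm equation over the algebraic closure, which descends.\<close>

theorem positive_rank_if_no_norm_power:
  fixes f :: "'a::field_char_0 poly"
  assumes odd: "odd (Polynomial.degree f)"
    and simple: "\<And>x. poly (ac_poly f) x = 0 \<Longrightarrow> poly (pderiv (ac_poly f)) x \<noteq> 0"
    and y0: "poly f x0 = y0^2" "y0 \<noteq> 0"
    and no_norm: "\<And>A B c n. n > 0 \<Longrightarrow> c \<noteq> 0 \<Longrightarrow> poly A x0 \<noteq> 0 \<Longrightarrow>
      A^2 - f * B^2 \<noteq> smult c ([:-x0, 1:] ^ n)"
  shows "jacobian_positive_rank f"
proof -
  define F where "F = ac_poly f"
  define P where "P = place_at F (to_ac x0) (to_ac y0)"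
  define P' where "P' = place_at F (to_ac x0) (- to_ac y0)"
  define E where "E = frag_of P - frag_of P'"
  define Z where "Z = principal_divisors F #>\<^bsub>Div F\<^esub> E"
  have oddF: "odd (Polynomial.degree F)"
    using odd by (simp add: F_def degree_ac_poly)
  have yF: "poly F (to_ac x0) = (to_ac y0)^2" "to_ac y0 \<noteq> 0"
    using y0 by (simp_all add: F_def poly_ac_poly)
  have PP: "P \<in> places F" "P' \<in> places F" "P \<noteq> P'"
    unfolding P_def P'_def
    using place_at_in_places[OF oddF yF] place_at_in_places[OF oddF, of "to_ac x0" "- to_ac y0"]
      place_at_neq_conj[OF oddF yF] yF by simp_all
  have keysE: "Poly_Mapping.keys E \<subseteq> {P, P'}"
    unfolding E_def using keys_diff[of "frag_of P" "frag_of P'"] by auto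
  have carrE: "E \<in> carrier (Div F)"
    using keysE PP by auto
  have "div_degree E = (\<Sum>v\<in>{P, P'}. Poly_Mapping.lookup E v)"
    unfolding div_degree_def
    by (rule sum.mono_neutral_left) (use keysE in \<open>auto simp: in_keys_iff\<close>)
  also have "\<dots> = 0"
    using PP(3) by (simp add: E_def lookup_minus)
  finally have degE: "div_degree E = 0" .
  have "galois_div \<sigma> ` Z = Z" if s: "\<sigma> \<in> galois_group" for \<sigma>
  proof -
    \<comment> \<open>Both points have coordinates in the ground field, so each is fixed, and the
      divisor itself is invariant, not only its class.\<close>
    have "galois_place \<sigma> P = P"
      unfolding P_def F_def by (rule galois_place_place_at[OF s odd y0])
    moreover have "galois_place \<sigma> P' = P'"
      unfolding P'_def F_def using galois_place_place_at[OF s odd, of x0 "- y0"] y0 by simp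
    ultimately have "galois_div \<sigma> E = E"
      by (simp add: galois_div_def E_def frag_extend_diff)
    thus ?thesis
      unfolding Z_def F_def by (rule galois_div_coset[OF s])
  qed
  hence Z: "Z \<in> carrier (jacobian_points f)"
    using carrE degE by (auto simp: jacobian_points_def Pic0_def F_def[symmetric] Z_def)
  have "Z [^]\<^bsub>jacobian_points f\<^esub> n \<noteq> \<one>\<^bsub>jacobian_points f\<^esub>" if n: "n > 0" for n :: nat
  proof
    assume "Z [^]\<^bsub>jacobian_points f\<^esub> n = \<one>\<^bsub>jacobian_points f\<^esub>"
    hence "principal_divisors F #>\<^bsub>Div F\<^esub> (frag_cmul (int n) E) = principal_divisors F"
      using jacobian_points_pow[OF odd, of E n] carrE
      by (simp add: Z_def F_def jacobian_points_def Pic0_def)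
    moreover have "frag_cmul (int n) E \<in> carrier (Div F)"
      using carrE keys_cmul[of "int n" E] by auto
    ultimately have "frag_cmul (int n) E \<in> principal_divisors F"
      using group.coset_join1[OF group_free_Abelian_group] principal_divisors_subgroup[OF oddF]
      by blast
    then obtain g where g: "g \<noteq> 0"
      "\<And>v. v \<in> places F \<Longrightarrow> int n * Poly_Mapping.lookup E v = v g"
      by (auto simp: principal_divisors_def)
    have simpleF: "\<And>x. poly F x = 0 \<Longrightarrow> poly (pderiv F) x \<noteq> 0"
      using simple by (simp add: F_def)
    have "\<exists>A B c. A^2 - F * B^2 = smult c ([:- to_ac x0, 1:] ^ (2 * n)) \<and>
        poly A (to_ac x0) + poly B (to_ac x0) * to_ac y0 = 0 \<and> poly A (to_ac x0) \<noteq> 0"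
    proof (rule divisor_relation_imp_norm_eq[OF oddF simpleF yF g(1) n])
      show "place_at F (to_ac x0) (to_ac y0) g = int n"
        using g(2)[OF PP(1)] PP(3) by (simp add: E_def lookup_minus P_def)
      show "place_at F (to_ac x0) (- to_ac y0) g = - int n"
        using g(2)[OF PP(2)] PP(3) by (simp add: E_def lookup_minus P'_def)
      show "v g = 0" if "v \<in> places F" "v \<noteq> place_at F (to_ac x0) (to_ac y0)"
        "v \<noteq> place_at F (to_ac x0) (- to_ac y0)" for v
        using g(2)[OF that(1)] that by (simp add: E_def lookup_minus P_def P'_def)
    qed
    then obtain A B c where "A^2 - ac_poly f * B^2 = smult c ([:- to_ac x0, 1:] ^ (2 * n))"
      "poly A (to_ac x0) + poly B (to_ac x0) * to_ac y0 = 0" "poly A (to_ac x0) \<noteq> 0"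
      unfolding F_def by blast
    \<comment> \<open>Descent to the ground field, where \<open>no_norm\<close> excludes such an
      equation.\<close>
    hence "\<exists>A B c. A^2 - f * B^2 = smult c ([:-x0, 1:] ^ (2 * n)) \<and> c \<noteq> 0 \<and> poly A x0 \<noteq> 0"
      using norm_eq_power_descent[OF odd y0, of A B c "2 * n"] n by simp
    thus False
      using no_norm[of "2 * n"] n by auto
  qed
  thus ?thesis
    unfolding jacobian_positive_rank_def using Z by blast
qed

section \<open>Twists with a nonconstant point\<close>

locale field_derivation =
  fixes D :: "'a::field_char_0 \<Rightarrow> 'a"
  assumes D_add: "D (x + y) = D x + D y"
    and D_mult: "D (x * y) = D x * y + x * D y"
begin

lemma D_0: "D 0 = 0"
  using D_add[of 0 0] by simp

lemma D_1: "D 1 = 0"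
  using D_mult[of 1 1] by simp

lemma D_minus: "D (x - y) = D x - D y"
  using D_add[of "x - y" y] by (simp add: algebra_simps)

lemma D_of_nat: "D (of_nat n) = 0"
  by (induction n) (simp_all add: D_0 D_1 D_add)

lemma D_of_int: "D (of_int k) = 0"
  by (cases k rule: int_diff_cases) (simp add: D_minus D_of_nat)

lemma D_of_int_mult: "D (of_int k * x) = of_int k * D x"
  by (simp add: D_mult D_of_int)

lemma D_power2: "D (x^2) = 2 * x * D x"
  by (simp add: power2_eq_square D_mult)

lemma D_power: "D (x ^ n) = of_nat n * x ^ (n - 1) * D x"
proof (induction n)
  case (Suc n)
  then show ?case
    by (cases n) (simp_all add: D_mult algebra_simps)
qed (simp add: D_1)

text \<open>
  Over the algebraic closure the curve becomes \<open>Y\<^sup>2 = X\<^sup>m + 1\<close> with \<open>Y\<^sup>2 = y\<^sup>2 / e\<close>, so the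
  hypothesis says that the point is not constant on this constant curve. The twisted derivation
  kills \<open>X\<close>.
\<close>

lemma twist_positive_rank:
  fixes d e x0 y0 :: 'a
  assumes m: "m \<ge> 3" "odd m" and d: "d \<noteq> 0" and e: "e \<noteq> 0"
    and point: "d * x0 ^ m + e = y0^2" and nonconst: "D (y0^2 / e) \<noteq> 0"
  shows "jacobian_positive_rank (Polynomial.monom d m + [:e:])"
proof -
  define f where "f = Polynomial.monom d m + [:e:]"
  \<comment> \<open>Chosen so that the derivation multiplies d x^m by the same factor
    \<open>D e / e\<close> by which it multiplies \<open>e\<close>; hence \<open>f\<close> is an
    eigenvector.\<close>
  define \<epsilon> where "\<epsilon> = (D e / e - D d / d) / of_nat m"
  define \<delta> where "\<delta> p = map_poly D p + smult \<epsilon> ([:0, 1:] * pderiv p)" for p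
  have m0: "of_nat m \<noteq> (0 :: 'a)"
    using m by simp
  interpret \<delta>: poly_derivation \<delta>
    unfolding \<delta>_def by (rule poly_derivation_twisted[OF D_add D_mult])
  have degf: "Polynomial.degree f = m"
    unfolding f_def using d m by (subst degree_add_eq_left) (simp_all add: degree_monom_eq)
  have y0: "poly f x0 = y0^2" "y0 \<noteq> 0"
    using point nonconst by (auto simp: f_def poly_monom D_0)
  have "\<delta> (Polynomial.monom d m) = Polynomial.monom (D d + \<epsilon> * (of_nat m * d)) m"
  proof -
    have "[:0, 1:] * pderiv (Polynomial.monom d m) = Polynomial.monom (of_nat m * d) m"
      using m by (cases m) (simp_all add: pderiv_monom flip: monom_Suc)
    thus ?thesis
      by (simp add: \<delta>_def map_poly_monom D_0 smult_monom add_monom)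
  qed
  also have "D d + \<epsilon> * (of_nat m * d) = D e / e * d"
    using d e m0 by (simp add: \<epsilon>_def field_simps)
  finally have \<delta>f: "\<delta> f = smult (2 * (D e / e / 2)) f"
    using e by (simp add: f_def \<delta>.d_add smult_add_right smult_monom)
      (simp add: \<delta>_def map_poly_pCons D_0)
  have \<delta>x: "\<delta> [:-x0, 1:] = smult \<epsilon> [:-x0, 1:] + [:\<epsilon> * x0 - D x0:]"
    using D_minus[of 0 x0] by (simp add: \<delta>_def map_poly_pCons D_0 D_1 pderiv_pCons)
  \<comment> \<open>Otherwise d x0^m and \<open>e\<close> would have proportional derivatives with
    the same factor \<open>D e / e\<close>, and so would their sum y0^2, making y0^2 / e
    constant.\<close>
  have t: "\<epsilon> * x0 - D x0 \<noteq> 0"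
  proof
    assume "\<epsilon> * x0 - D x0 = 0"
    hence Dx0: "D x0 = \<epsilon> * x0"
      by simp
    have "D (x0 ^ m) = of_nat m * \<epsilon> * x0 ^ m"
      unfolding D_power Dx0 using m by (cases m) simp_all
    hence "D (d * x0 ^ m) = (D d + \<epsilon> * (of_nat m * d)) * x0 ^ m"
      by (simp add: D_mult algebra_simps)
    also have "\<dots> = D e / e * (d * x0 ^ m)"
      using d e m0 by (simp add: \<epsilon>_def field_simps)
    finally have 1: "D (y0^2) = D e / e * y0^2"
      unfolding point[symmetric] using e by (simp add: D_add algebra_simps)
    have "D (y0^2 / e * e) = D (y0^2 / e) * e + y0^2 / e * D e"
      by (rule D_mult)
    hence "D (y0^2 / e) * e = 0"
      using 1 e by (simp add: mult.commute)
    thus False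
      using nonconst e by simp
  qed
  have simple: "poly (pderiv (ac_poly f)) x \<noteq> 0" if "poly (ac_poly f) x = 0" for x
  proof
    assume der: "poly (pderiv (ac_poly f)) x = 0"
    have F: "ac_poly f = Polynomial.monom (to_ac d) m + [:to_ac e:]"
      by (simp add: f_def ac_poly_add map_poly_monom ac_poly_pCons)
    \<comment> \<open>The derivative m d x^(m-1) vanishes only at 0, where \<open>f\<close> takes
      the nonzero value \<open>e\<close>.\<close>
    have "x = 0"
      using der d m0 m unfolding F by (simp add: pderiv_add pderiv_monom poly_monom pderiv_pCons)
    thus False
      using that e m unfolding F by (simp add: poly_monom power_0_left)
  qed
  have "jacobian_positive_rank f"
  proof (rule positive_rank_if_no_norm_power[OF _ simple y0])
    show "odd (Polynomial.degree f)"
      using m degf by simp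
  next
    fix A B :: "'a poly" and c :: 'a and n :: nat
    assume "n > 0" "c \<noteq> 0" "poly A x0 \<noteq> 0"
    thus "A^2 - f * B^2 \<noteq> smult c ([:-x0, 1:] ^ n)"
      using \<delta>.norm_eq_power_contradiction[OF _ _ \<delta>f \<delta>x t] degf m by blast
  qed
  thus ?thesis
    by (simp add: f_def)
qed

end

section \<open>Extending a derivation to the fraction field by the quotient rule\<close>

definition fract_deriv :: "('a::idom \<Rightarrow> 'a) \<Rightarrow> 'a fract \<Rightarrow> 'a fract" where
  "fract_deriv D q = (THE r. \<exists>a b. b \<noteq> 0 \<and> q = Fraction_Field.Fract a b \<and>
     r = Fraction_Field.Fract (D a * b - a * D b) (b * b))"

text \<open>Independence of the representative follows by differentiating the relation
  \<open>a * d = c * b\<close>.\<close>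

lemma fract_deriv_Fract:
  assumes mult: "\<And>x y. D (x * y) = D x * y + x * D y" and b: "b \<noteq> 0"
  shows "fract_deriv D (Fraction_Field.Fract a b) =
    Fraction_Field.Fract (D a * b - a * D b) (b * b)"
  unfolding fract_deriv_def
proof (rule the_equality)
  show "\<exists>c d. d \<noteq> 0 \<and> Fraction_Field.Fract a b = Fraction_Field.Fract c d \<and>
      Fraction_Field.Fract (D a * b - a * D b) (b * b) = Fraction_Field.Fract (D c * d - c * D d) (d * d)"
    using b by blast
next
  fix r
  assume "\<exists>c d. d \<noteq> 0 \<and> Fraction_Field.Fract a b = Fraction_Field.Fract c d \<and>
      r = Fraction_Field.Fract (D c * d - c * D d) (d * d)"
  then obtain c d where d: "d \<noteq> 0" and eq: "Fraction_Field.Fract a b = Fraction_Field.Fract c d"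
    and r: "r = Fraction_Field.Fract (D c * d - c * D d) (d * d)"
    by blast
  have e: "a * d = c * b"
    using eq b d by (simp add: eq_fract)
  have De: "D a * d + a * D d = D c * b + c * D b"
    using mult[of a d] mult[of c b] e by simp
  have "(D c * d - c * D d) * (b * b) = (D c * b) * (b * d) - (c * b) * (b * D d)"
    by (simp add: algebra_simps)
  also have "D c * b = D a * d + a * D d - c * D b"
    using De by (simp add: algebra_simps)
  also have "(D a * d + a * D d - c * D b) * (b * d) - (c * b) * (b * D d) =
      D a * b * (d * d) + (a * d) * (b * D d) - (c * b) * (D b * d) - (c * b) * (b * D d)"
    by (simp add: algebra_simps)
  also have "\<dots> = (D a * b - a * D b) * (d * d)"
    unfolding e[symmetric] by (simp add: algebra_simps)
  finally show "r = Fraction_Field.Fract (D a * b - a * D b) (b * b)"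
    unfolding r using b d by (simp add: eq_fract)
qed

lemma fract_deriv_derivation:
  fixes D :: "'a::linordered_idom \<Rightarrow> 'a"
  assumes add: "\<And>x y. D (x + y) = D x + D y"
    and mult: "\<And>x y. D (x * y) = D x * y + x * D y"
  shows "field_derivation (fract_deriv D)"
proof
  fix x y :: "'a fract"
  obtain a b where x: "x = Fraction_Field.Fract a b" "b \<noteq> 0"
    by (cases x) auto
  obtain c d where y: "y = Fraction_Field.Fract c d" "d \<noteq> 0"
    by (cases y) auto
  show "fract_deriv D (x + y) = fract_deriv D x + fract_deriv D y"
    using x y by (simp add: fract_deriv_Fract[OF mult] add mult eq_fract algebra_simps)
  show "fract_deriv D (x * y) = fract_deriv D x * y + x * fract_deriv D y"
    using x y by (simp add: fract_deriv_Fract[OF mult] add mult eq_fract algebra_simps)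
qed

section \<open>The choice of the twist and the three points\<close>

theorem theorem4p1:
  fixes a b c :: int and m :: nat
  assumes "a \<noteq> 0" and "b \<noteq> 0" and "c \<noteq> 0" and "m \<ge> 3" and "odd m"
  shows "\<exists>D :: Quvw. D \<noteq> 0 \<and>
    jacobian_positive_rank (Polynomial.monom D m + [:of_int a:]) \<and>
    jacobian_positive_rank (Polynomial.monom D m + [:of_int b:]) \<and>
    jacobian_positive_rank (Polynomial.monom 1 m + [:of_int c * D:])"
proof -
  \<comment> \<open>This is d/dw, as w is the outermost polynomial variable.\<close>
  define \<theta> :: "Quvw \<Rightarrow> Quvw" where "\<theta> = fract_deriv pderiv"
  interpret field_derivation \<theta>
    unfolding \<theta>_def
    by (rule fract_deriv_derivation) (simp_all add: pderiv_add pderiv_mult algebra_simps)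
  define w :: Quvw where "w = Fraction_Field.Fract [:0, 1:] 1"
  have Dw: "\<theta> w = 1"
    unfolding \<theta>_def w_def
    by (subst fract_deriv_Fract)
      (simp_all add: pderiv_mult algebra_simps pderiv_pCons One_fract_def flip: one_pCons)
  have w0: "w \<noteq> 0"
    using Dw D_0 by auto
  \<comment> \<open>The equation y2^2 - y1^2 = b - a is solved by splitting b - a as z w, with y2 -
    y1 = z and y2 + y1 = w.\<close>
  define z where "z = of_int (b - a) / w"
  define y1 where "y1 = (w - z) / 2"
  define y2 where "y2 = (w + z) / 2"
  have zw: "z * w = of_int (b - a)"
    using w0 by (simp add: z_def)
  hence "\<theta> z * w + z = 0"
    using D_mult[of z w] D_of_int[of "b - a"] Dw by simp
  hence Dz: "\<theta> z = - z / w"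
    using w0 by (simp add: field_simps add_eq_0_iff)
  have D2: "2 * \<theta> y = \<theta> (2 * y)" for y
    using D_of_int_mult[of 2 y] by simp
  have y: "2 * y1 = w - z" "2 * y2 = w + z"
    by (simp_all add: y1_def y2_def)
  have "2 * \<theta> y1 = (w + z) / w" "2 * \<theta> y2 = (w - z) / w"
    unfolding D2 y using w0 by (simp_all add: D_add D_minus Dw Dz field_simps)
  hence "2 * \<theta> y1 = 2 * (y2 / w)" "2 * \<theta> y2 = 2 * (y1 / w)"
    by (simp_all flip: y)
  hence Dy: "\<theta> y1 = y2 / w" "\<theta> y2 = y1 / w"
    by simp_all
  have w_eq: "w = y1 + y2"
    by (simp add: y1_def y2_def field_simps)
  \<comment> \<open>If one of them vanished, so would its derivative and hence the other,
    contradicting y1 + y2 = w.\<close>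
  have y1: "y1 \<noteq> 0" and y2: "y2 \<noteq> 0"
    using Dy D_0 w_eq w0 by auto
  \<comment> \<open>Not the indeterminate u, but the common value y1^2 - a = y2^2 - b.\<close>
  define u where "u = y1^2 - of_int a"
  have "y2^2 - y1^2 = z * w"
    by (simp add: y1_def y2_def power2_eq_square field_simps)
  hence u2: "u = y2^2 - of_int b"
    unfolding zw u_def by (simp add: algebra_simps)
  have Du: "\<theta> u = 2 * y1 * \<theta> y1"
    by (simp add: u_def D_minus D_of_int D_power2)
  hence Du0: "\<theta> u \<noteq> 0"
    using y1 y2 w0 by (simp add: Dy)
  hence u0: "u \<noteq> 0"
    using D_0 by auto
  \<comment> \<open>Any nonzero \<open>x1\<close> would serve the first two curves. This one makes
    x1^(-m) + c D = (1 + c u) / x1^m equal to x1^(1-m), a square because m is odd.\<close>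
  define x1 where "x1 = 1 + of_int c * u"
  have "\<theta> x1 = of_int c * \<theta> u"
    by (simp add: x1_def D_add D_1 D_of_int_mult)
  hence x1: "x1 \<noteq> 0"
    using Du0 assms(3) D_0 by auto
  define d where "d = u / x1 ^ m"
  have d0: "d \<noteq> 0" and dx: "d * x1 ^ m = u"
    using u0 x1 by (simp_all add: d_def)
  have const: "\<theta> (y^2 / of_int k) \<noteq> 0" if "k \<noteq> 0" "y \<noteq> 0" "\<theta> y \<noteq> 0" for y k
    using D_mult[of "y^2 / of_int k" "of_int k"] D_power2[of y] that by (auto simp: D_of_int)
  have r1: "jacobian_positive_rank (Polynomial.monom d m + [:of_int a:])"
    by (rule twist_positive_rank[of m d "of_int a" x1 y1])
      (use assms d0 y1 y2 w0 in \<open>auto simp: dx u_def const Dy\<close>)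
  have r2: "jacobian_positive_rank (Polynomial.monom d m + [:of_int b:])"
    by (rule twist_positive_rank[of m d "of_int b" x1 y2])
      (use assms d0 y1 y2 w0 in \<open>auto simp: dx u2 const Dy\<close>)
  obtain j where j: "m = 2 * j + 1"
    using assms(5) by (rule oddE)
  have pt: "1 * (1 / x1) ^ m + of_int c * d = (1 / x1 ^ j)^2"
  proof -
    have "1 * (1 / x1) ^ m + of_int c * d = x1 / x1 ^ m"
      by (simp add: d_def x1_def power_one_over add_divide_distrib field_simps)
    also have "\<dots> = (1 / x1 ^ j)^2"
      using x1 by (simp add: j power_mult power_one_over power2_eq_square field_simps power_add)
    finally show ?thesis .
  qed
  \<comment> \<open>The quantity required to be nonconstant on the third curve; q - 1 is the inverse
    of c u, and u varies with w.\<close>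
  define q where "q = (1 / x1 ^ j)^2 / (of_int c * d)"
  have "(q - 1) * (of_int c * d) = (1 / x1) ^ m"
    using d0 assms(3) unfolding q_def by (simp add: left_diff_distrib flip: pt)
  hence "(q - 1) * (of_int c * (d * x1 ^ m)) = (1 / x1) ^ m * x1 ^ m"
    by (simp add: mult.assoc[symmetric])
  hence q: "(q - 1) * (of_int c * u) = 1"
    using x1 unfolding dx by (simp add: power_one_over)
  have "\<theta> q \<noteq> 0"
  proof
    assume "\<theta> q = 0"
    hence "(q - 1) * (of_int c * \<theta> u) = 0"
      using D_mult[of "q - 1" "of_int c * u"] q by (simp add: D_minus D_1 D_of_int_mult)
    thus False
      using q Du0 assms(3) by auto
  qed
  hence r3: "jacobian_positive_rank (Polynomial.monom 1 m + [:of_int c * d:])"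
    by (intro twist_positive_rank[of m 1 "of_int c * d" "1 / x1" "1 / x1 ^ j"])
      (use assms d0 pt in \<open>auto simp: q_def\<close>)
  show ?thesis
    using d0 r1 r2 r3 by blast
qed

end
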